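(* Let $\Omega\subset\mathbb R^d$ be nonempty, open, connected with Lebesgue-negligible boundary, $\lambda>0$, and let $P$ be a Borel probability measure on $\mathcal P_2(\mathbb R^d)$ such that $\int_{\mathcal P_2(\mathbb R^d)}m_2(\nu)\,dP(\nu)<+\infty$. Then the problem $$\inf_{\rho\in\mathcal P_2(\mathbb R^d)}\ \frac12\int_{\mathcal P_2(\mathbb R^d)}W_2^2(\rho,\nu)\,dP(\nu)+\lambda\,\mathrm{Ent}_\Omega(\rho)$$ admits a unique solution.
   Context: $m_2(\nu)=\int_{\mathbb R^d}\|x\|^2d\nu(x)$; $\mathcal P_2(\mathbb R^d)$ is the set of Borel probability measures on $\mathbb R^d$ with $m_2<\infty$, endowed with the $2$-Wasserstein distance $W_2$, $W_2^2(\mu,\nu)=\inf_{\gamma\in\Pi(\mu,\nu)}\int\|x-y\|^2d\gamma(x,y)$, where $\Pi(\mu,\nu)$ is the set of transport plans. $\mathrm{Ent}_\Omega(\mu)=\int_\Omega\rho\log\rho$ if $\mu=\rho\,dx$ with $\int_\Omega\rho=1$, and $\mathrm{Ent}_\Omega(\mu)=+\infty$ otherwise. *)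

theory Defs
  imports "HOL-Probability.Probability"
begin

definition second_moment :: "'a::euclidean_space measure \<Rightarrow> ennreal"
  where "second_moment \<nu> = (\<integral>\<^sup>+ x. ennreal ((norm x)\<^sup>2) \<partial>\<nu>)"

definition P2 :: "'a::euclidean_space measure set"
  where "P2 = {\<mu>. prob_space \<mu> \<and> sets \<mu> = sets borel \<and> second_moment \<mu> < \<infinity>}"

definition transport_plans ::
    "'a::euclidean_space measure \<Rightarrow> 'a measure \<Rightarrow> ('a \<times> 'a) measure set"
  where "transport_plans \<mu> \<nu> =
    {\<gamma>. prob_space \<gamma> \<and> sets \<gamma> = sets (borel \<Otimes>\<^sub>M borel) \<and>
         distr \<gamma> borel fst = \<mu> \<and> distr \<gamma> borel snd = \<nu>}"

text \<open>On \<^term>\<open>P2\<close> the infimum is finite, so that \<^term>\<open>enn2real\<close> loses nothing there.\<close>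

definition W2 :: "'a::euclidean_space measure \<Rightarrow> 'a measure \<Rightarrow> real"
  where "W2 \<mu> \<nu> =
    sqrt (enn2real (INF \<gamma>\<in>transport_plans \<mu> \<nu>.
      \<integral>\<^sup>+ z. ennreal ((dist (fst z) (snd z))\<^sup>2) \<partial>\<gamma>))"

text \<open>The Borel \<open>\<sigma>\<close>-algebra of the metric space \<open>(P2, W2)\<close>. The open sets are spelled out
  because the facts about \<^const>\<open>Metric_space.mtopology\<close> are only available once the
  triangle inequality for \<^const>\<open>W2\<close> has been proved; the lemma below relates the two.\<close>

definition borel_P2 :: "'a::euclidean_space measure measure"
  where "borel_P2 =
    sigma P2 {U. U \<subseteq> P2 \<and> (\<forall>\<mu>\<in>U. \<exists>\<epsilon>>0. \<forall>\<nu>\<in>P2. W2 \<mu> \<nu> < \<epsilon> \<longrightarrow> \<nu> \<in> U)}"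

lemma borel_P2_eq_mtopology:
  assumes "Metric_space (P2 :: 'a::euclidean_space measure set) W2"
  shows "(borel_P2 :: 'a measure measure) =
    sigma P2 {U. openin (Metric_space.mtopology P2 W2) U}"
proof -
  have "openin (Metric_space.mtopology P2 W2) U \<longleftrightarrow>
      U \<subseteq> P2 \<and> (\<forall>\<mu>\<in>U. \<exists>\<epsilon>>0. \<forall>\<nu>\<in>P2. W2 \<mu> \<nu> < \<epsilon> \<longrightarrow> \<nu> \<in> U)"
    for U :: "'a measure set"
    unfolding Metric_space.openin_mtopology[OF assms] Metric_space.mball_def[OF assms]
    by (safe; blast)
  then show ?thesis
    by (simp add: borel_P2_def)
qed

text \<open>The integral of \<open>f\<close> over \<open>A\<close> as (integral of positive part) minus (integral of negative
  part). It is meaningful when at most one of the two is infinite; in \<^typ>\<open>ereal\<close>,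
  \<open>\<infinity> - \<infinity> = \<infinity>\<close>.\<close>

definition extended_integral :: "'a measure \<Rightarrow> 'a set \<Rightarrow> ('a \<Rightarrow> real) \<Rightarrow> ereal"
  where "extended_integral M A f =
    enn2ereal (\<integral>\<^sup>+ x\<in>A. ennreal (f x) \<partial>M) - enn2ereal (\<integral>\<^sup>+ x\<in>A. ennreal (- f x) \<partial>M)"

text \<open>The density is taken to be the Radon-Nikodym derivative; by the lemma below any other
  density yields the same value. For \<open>\<mu> \<in> P2\<close> the negative part of \<open>\<rho> log \<rho>\<close> is integrable,
  so the entropy is then a well-defined element of \<open>(-\<infinity>, \<infinity>]\<close>.\<close>

definition Ent :: "'a::euclidean_space set \<Rightarrow> 'a measure \<Rightarrow> ereal"
  where "Ent \<Omega> \<mu> =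
    (let \<rho> = (\<lambda>x. enn2real (RN_deriv lborel \<mu> x)) in
     if density lborel (\<lambda>x. ennreal (\<rho> x)) = \<mu> \<and> (\<integral>\<^sup>+ x\<in>\<Omega>. ennreal (\<rho> x) \<partial>lborel) = 1
     then extended_integral lborel \<Omega> (\<lambda>x. \<rho> x * ln (\<rho> x))
     else \<infinity>)"

lemma Ent_density:
  fixes \<rho> :: "'a::euclidean_space \<Rightarrow> real"
  assumes [measurable]: "\<rho> \<in> borel_measurable borel" and nonneg: "\<And>x. 0 \<le> \<rho> x"
    and mass: "(\<integral>\<^sup>+ x\<in>\<Omega>. ennreal (\<rho> x) \<partial>lborel) = 1"
  shows "Ent \<Omega> (density lborel (\<lambda>x. ennreal (\<rho> x))) =
    extended_integral lborel \<Omega> (\<lambda>x. \<rho> x * ln (\<rho> x))"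
proof -
  define \<mu> where "\<mu> = density lborel (\<lambda>x. ennreal (\<rho> x))"
  define \<sigma> where "\<sigma> = (\<lambda>x. enn2real (RN_deriv lborel \<mu> x))"
  have [measurable]: "\<sigma> \<in> borel_measurable borel"
    unfolding \<sigma>_def using borel_measurable_RN_deriv[of lborel \<mu>] by simp
  have "density lborel (RN_deriv lborel \<mu>) = density lborel (\<lambda>x. ennreal (\<rho> x))"
    unfolding \<mu>_def by (rule density_RN_deriv_density) simp
  then have "AE x in lborel. RN_deriv lborel \<mu> x = ennreal (\<rho> x)"
    by (intro sigma_finite_measure.density_unique[OF sigma_finite_lborel]) auto
  then have ae: "AE x in lborel. \<sigma> x = \<rho> x"
    by eventually_elim (simp add: \<sigma>_def nonneg)
  have "density lborel (\<lambda>x. ennreal (\<sigma> x)) = \<mu>"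
    unfolding \<mu>_def using ae by (intro density_cong) auto
  moreover have "(\<integral>\<^sup>+ x\<in>\<Omega>. ennreal (\<sigma> x) \<partial>lborel) = 1"
    unfolding mass[symmetric] using ae by (intro nn_integral_cong_AE) auto
  moreover have "extended_integral lborel \<Omega> (\<lambda>x. \<sigma> x * ln (\<sigma> x)) =
      extended_integral lborel \<Omega> (\<lambda>x. \<rho> x * ln (\<rho> x))"
  proof -
    have "(\<integral>\<^sup>+ x\<in>\<Omega>. ennreal (\<sigma> x * ln (\<sigma> x)) \<partial>lborel) =
        (\<integral>\<^sup>+ x\<in>\<Omega>. ennreal (\<rho> x * ln (\<rho> x)) \<partial>lborel)"
      using ae by (intro nn_integral_cong_AE) auto
    moreover have "(\<integral>\<^sup>+ x\<in>\<Omega>. ennreal (- (\<sigma> x * ln (\<sigma> x))) \<partial>lborel) =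
        (\<integral>\<^sup>+ x\<in>\<Omega>. ennreal (- (\<rho> x * ln (\<rho> x))) \<partial>lborel)"
      using ae by (intro nn_integral_cong_AE) auto
    ultimately show ?thesis
      by (simp only: extended_integral_def)
  qed
  ultimately have "Ent \<Omega> \<mu> = extended_integral lborel \<Omega> (\<lambda>x. \<rho> x * ln (\<rho> x))"
    unfolding Ent_def Let_def \<sigma>_def[symmetric] by simp
  then show ?thesis
    by (simp only: \<mu>_def)
qed

definition objective ::
    "'a::euclidean_space set \<Rightarrow> real \<Rightarrow> 'a measure measure \<Rightarrow> 'a measure \<Rightarrow> ereal"
  where "objective \<Omega> lam P \<rho> =
    ereal (1 / 2) * enn2ereal (\<integral>\<^sup>+ \<nu>. ennreal ((W2 \<rho> \<nu>)\<^sup>2) \<partial>P) + ereal lam * Ent \<Omega> \<rho>"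

end

theory Submission
  imports Defs
begin

text \<open>The objective is convex along linear interpolation of measures, since transport plans can be
  averaged, and the entropy is quantitatively strictly convex: at the midpoint of two densities
  \<open>f, g\<close> it gains at least \<open>\<integral>(\<surd>f - \<surd>g)\<^sup>2 / 4\<close>. This gives uniqueness, and it makes the square roots of
  the densities of a minimising sequence Cauchy in \<open>L\<^sup>2\<close>, so that a fast minimising sequence of
  densities converges almost everywhere without loss of mass; no weak compactness is needed.
  Second moments stay bounded along the sequence, as the transport term dominates them and a
  Gaussian bounds the negative part of the entropy. Fatou's lemma gives lower
  semicontinuity of the entropy up to an arbitrarily small multiple of the second moment, and modifying
  transport plans by the lost mass gives lower semicontinuity of the transport cost for almost
  everywhere convergent densities. The cost \<open>W2 \<mu>\<close> is Borel on \<open>P2\<close> by a triangle inequality.\<close>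

subsection \<open>Transport plans and costs\<close>

text \<open>The interpolation is linear because the squared Wasserstein distance is in general not
  convex along Wasserstein geodesics, whereas plans can be averaged. Strict convexity alone would
  give only uniqueness; the explicit gap lives in L2 of the square roots, a complete space, so a
  small excess of energy becomes a small norm. Three losses in the limit must then be controlled.
  Mass: Fatou gives total mass at most 1, and the reverse comes from comparing \<open>g\<close> with
  \<open>f n\<close> through their square roots. Entropy: on an unbounded domain
  \<open>t * ln t\<close> has no integrable lower bound, so it is compared with the Gaussian
  \<open>exp (- \<epsilon> * (norm x)\<^sup>2)\<close>; this makes the integrand nonnegative at the
  price of \<open>\<epsilon>\<close> times the second moment, and a uniform moment bound lets
  \<open>\<epsilon>\<close> tend to 0 after the limit in \<open>n\<close>. Moments: those of
  \<open>f n\<close> may partly escape, so the transport estimate may involve only the positive part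
  of \<open>g - f n\<close>, which is dominated by \<open>g\<close>. For measurability, open balls
  must be open in the sense of \<open>borel_P2\<close>; a triangle inequality for squared costs with
  a factor \<open>1 + s\<close> close to 1 on one side, and a possibly huge one on the other, is
  enough for that.\<close>

definition plus_measure :: "'a measure \<Rightarrow> 'a measure \<Rightarrow> 'a measure"
  where "plus_measure M N = measure_of (space M) (sets M) (\<lambda>A. emeasure M A + emeasure N A)"

lemma space_plus_measure [simp]: "space (plus_measure M N) = space M"
  by (simp add: plus_measure_def)

lemma sets_plus_measure [simp, measurable_cong]: "sets (plus_measure M N) = sets M"
  by (simp add: plus_measure_def)

lemma emeasure_plus_measure:
  assumes "sets N = sets M" and "A \<in> sets M"
  shows "emeasure (plus_measure M N) A = emeasure M A + emeasure N A"
  unfolding plus_measure_def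
proof (rule emeasure_measure_of_sigma)
  show "sigma_algebra (space M) (sets M)" ..
  show "positive (sets M) (\<lambda>A. emeasure M A + emeasure N A)"
    by (simp add: positive_def)
  show "countably_additive (sets M) (\<lambda>A. emeasure M A + emeasure N A)"
    using assms(1) by (auto simp: countably_additive_def suminf_emeasure suminf_add[symmetric])
qed fact

lemma nn_integral_plus_measure:
  assumes "sets N = sets M" and "f \<in> borel_measurable M"
  shows "(\<integral>\<^sup>+x. f x \<partial>plus_measure M N) = (\<integral>\<^sup>+x. f x \<partial>M) + (\<integral>\<^sup>+x. f x \<partial>N)"
  using assms(2)
proof (induction rule: borel_measurable_induct)
  case (cong f g)
  moreover have "space N = space M"
    using assms(1) by (rule sets_eq_imp_space_eq)
  ultimately show ?case
    using nn_integral_cong[of M f g] nn_integral_cong[of N f g]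
      nn_integral_cong[of "plus_measure M N" f g]
    by simp
next
  case (set A)
  then show ?case
    using assms(1) by (simp add: emeasure_plus_measure)
next
  case (mult u c)
  moreover have "u \<in> borel_measurable N" "u \<in> borel_measurable (plus_measure M N)"
    using mult(2) assms(1) by (simp_all cong: measurable_cong_sets)
  ultimately show ?case
    by (simp add: nn_integral_cmult distrib_left)
next
  case (add u v)
  moreover have "u \<in> borel_measurable N" "u \<in> borel_measurable (plus_measure M N)"
    "v \<in> borel_measurable N" "v \<in> borel_measurable (plus_measure M N)"
    using add assms(1) by (simp_all cong: measurable_cong_sets)
  ultimately show ?case
    by (simp add: nn_integral_add ac_simps)
next
  case (seq U)
  have meas: "U i \<in> borel_measurable N" "U i \<in> borel_measurable (plus_measure M N)" for i
    using seq(1) assms(1) by (simp_all cong: measurable_cong_sets)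
  have inc: "incseq (\<lambda>i. integral\<^sup>N M (U i))" "incseq (\<lambda>i. integral\<^sup>N N (U i))"
    using seq(3) by (auto simp: incseq_def le_fun_def intro!: nn_integral_mono)
  show ?case
    unfolding SUP_apply image_comp o_def
    using seq meas inc
    by (simp add: nn_integral_monotone_convergence_SUP ennreal_SUP_add)
qed

text \<open>This is the infimum inside \<open>W2\<close>, kept in \<open>ennreal\<close> so that
  estimates carry neither finiteness conditions nor square roots; \<open>W2_sq\<close> translates
  back on \<open>P2\<close>.\<close>

definition transport_cost :: "'a::euclidean_space measure \<Rightarrow> 'a measure \<Rightarrow> ennreal"
  where "transport_cost \<mu> \<nu> =
    (INF \<gamma>\<in>transport_plans \<mu> \<nu>. \<integral>\<^sup>+ z. ennreal ((dist (fst z) (snd z))\<^sup>2) \<partial>\<gamma>)"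

lemma P2D:
  assumes "\<mu> \<in> P2"
  shows "prob_space \<mu>" "sets \<mu> = sets borel" "second_moment \<mu> < \<infinity>"
  using assms by (auto simp: P2_def)

lemma transport_planD:
  assumes "\<gamma> \<in> transport_plans \<mu> \<nu>"
  shows "prob_space \<gamma>" "sets \<gamma> = sets (borel \<Otimes>\<^sub>M borel)"
    "distr \<gamma> borel fst = \<mu>" "distr \<gamma> borel snd = \<nu>"
  using assms by (auto simp: transport_plans_def)

lemma nn_integral_transport_plan:
  assumes "\<gamma> \<in> transport_plans \<mu> \<nu>" and [measurable]: "g \<in> borel_measurable borel"
  shows "(\<integral>\<^sup>+z. g (fst z) \<partial>\<gamma>) = (\<integral>\<^sup>+x. g x \<partial>\<mu>)" "(\<integral>\<^sup>+z. g (snd z) \<partial>\<gamma>) = (\<integral>\<^sup>+x. g x \<partial>\<nu>)"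
proof -
  note [measurable_cong] = transport_planD(2)[OF assms(1)]
  show "(\<integral>\<^sup>+z. g (fst z) \<partial>\<gamma>) = (\<integral>\<^sup>+x. g x \<partial>\<mu>)"
    by (subst transport_planD(3)[OF assms(1), symmetric], subst nn_integral_distr) auto
  show "(\<integral>\<^sup>+z. g (snd z) \<partial>\<gamma>) = (\<integral>\<^sup>+x. g x \<partial>\<nu>)"
    by (subst transport_planD(4)[OF assms(1), symmetric], subst nn_integral_distr) auto
qed

text \<open>The marginals are tested through integrals of indicators because the plans below are
  built by densities, images and sums, for which integral formulas are at hand. Total mass 1 follows
  from the first marginal.\<close>

lemma transport_planI:
  assumes "prob_space \<mu>" and "sets \<mu> = sets borel" and "sets \<nu> = sets borel"
    and sets: "sets \<gamma> = sets (borel \<Otimes>\<^sub>M borel)"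
    and fst: "\<And>A. A \<in> sets borel \<Longrightarrow> (\<integral>\<^sup>+z. indicator A (fst z) \<partial>\<gamma>) = emeasure \<mu> A"
    and snd: "\<And>A. A \<in> sets borel \<Longrightarrow> (\<integral>\<^sup>+z. indicator A (snd z) \<partial>\<gamma>) = emeasure \<nu> A"
  shows "\<gamma> \<in> transport_plans \<mu> \<nu>"
proof -
  note [measurable_cong] = sets
  have 1: "distr \<gamma> borel fst = \<mu>"
  proof (rule measure_eqI)
    fix A assume "A \<in> sets (distr \<gamma> borel fst)"
    then have [measurable]: "A \<in> sets borel"
      by simp
    have "emeasure (distr \<gamma> borel fst) A = (\<integral>\<^sup>+x. indicator A x \<partial>distr \<gamma> borel fst)"
      by simp
    then show "emeasure (distr \<gamma> borel fst) A = emeasure \<mu> A"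
      by (subst (asm) nn_integral_distr) (auto simp: fst)
  qed (simp add: assms)
  have 2: "distr \<gamma> borel snd = \<nu>"
  proof (rule measure_eqI)
    fix A assume "A \<in> sets (distr \<gamma> borel snd)"
    then have [measurable]: "A \<in> sets borel"
      by simp
    have "emeasure (distr \<gamma> borel snd) A = (\<integral>\<^sup>+x. indicator A x \<partial>distr \<gamma> borel snd)"
      by simp
    then show "emeasure (distr \<gamma> borel snd) A = emeasure \<nu> A"
      by (subst (asm) nn_integral_distr) (auto simp: snd)
  qed (simp add: assms)
  have "emeasure \<gamma> (space \<gamma>) = emeasure (distr \<gamma> borel fst) UNIV"
    by (subst emeasure_distr) auto
  also have "\<dots> = 1"
    unfolding 1 using prob_space.emeasure_space_1[OF assms(1)] sets_eq_imp_space_eq[OF assms(2)]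
    by simp
  finally have "prob_space \<gamma>"
    by (rule prob_spaceI)
  with 1 2 sets show ?thesis
    by (simp add: transport_plans_def)
qed

lemma pair_measure_transport_plan:
  assumes "prob_space \<mu>" "sets \<mu> = sets borel" "prob_space \<nu>" "sets \<nu> = sets borel"
  shows "\<mu> \<Otimes>\<^sub>M \<nu> \<in> transport_plans \<mu> \<nu>"
proof (rule transport_planI)
  note [measurable_cong] = assms(2,4)
  interpret N: prob_space \<nu> by fact
  have sp: "emeasure \<nu> UNIV = 1"
    using N.emeasure_space_1 sets_eq_imp_space_eq[OF assms(4)] by simp
  have sp': "emeasure \<mu> UNIV = 1"
    using prob_space.emeasure_space_1[OF assms(1)] sets_eq_imp_space_eq[OF assms(2)] by simp
  fix A :: "'a set" assume [measurable]: "A \<in> sets borel"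
  then have A: "A \<in> sets \<mu>" "A \<in> sets \<nu>"
    using assms by auto
  show "(\<integral>\<^sup>+z. indicator A (fst z) \<partial>(\<mu> \<Otimes>\<^sub>M \<nu>)) = emeasure \<mu> A"
    using sp A sets_eq_imp_space_eq[OF assms(4)] by (subst N.nn_integral_fst[symmetric]) simp_all
  show "(\<integral>\<^sup>+z. indicator A (snd z) \<partial>(\<mu> \<Otimes>\<^sub>M \<nu>)) = emeasure \<nu> A"
    using sp' A sets_eq_imp_space_eq[OF assms(2)] by (subst N.nn_integral_fst[symmetric]) simp_all
qed (use assms in \<open>auto intro!: sets_pair_measure_cong\<close>)

lemma dist_sq_le: "(dist x y)\<^sup>2 \<le> 2 * (norm x)\<^sup>2 + 2 * (norm y)\<^sup>2"
  for x y :: "'a::real_normed_vector"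
proof -
  have "(dist x y)\<^sup>2 \<le> (norm x + norm y)\<^sup>2"
    by (intro power_mono) (auto simp: dist_norm norm_triangle_ineq4)
  also have "\<dots> \<le> 2 * (norm x)\<^sup>2 + 2 * (norm y)\<^sup>2"
    using sum_squares_bound[of "norm x" "norm y"] by (simp add: power2_sum)
  finally show ?thesis .
qed

lemma norm_sq_le: "(norm x)\<^sup>2 \<le> 2 * (dist x y)\<^sup>2 + 2 * (norm y)\<^sup>2"
  for x y :: "'a::real_normed_vector"
proof -
  have "(norm x)\<^sup>2 \<le> (dist x y + norm y)\<^sup>2"
    using norm_triangle_ineq[of "x - y" y] by (intro power_mono) (auto simp: dist_norm)
  also have "\<dots> \<le> 2 * (dist x y)\<^sup>2 + 2 * (norm y)\<^sup>2"
    using sum_squares_bound[of "dist x y" "norm y"] by (simp add: power2_sum)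
  finally show ?thesis .
qed

lemma transport_cost_le:
  assumes "\<gamma> \<in> transport_plans \<mu> \<nu>"
  shows "transport_cost \<mu> \<nu> \<le> (\<integral>\<^sup>+ z. ennreal ((dist (fst z) (snd z))\<^sup>2) \<partial>\<gamma>)"
  unfolding transport_cost_def using assms by (rule INF_lower)

lemma transport_cost_le_second_moment:
  assumes "\<mu> \<in> P2" "\<nu> \<in> P2"
  shows "transport_cost \<mu> \<nu> \<le> 2 * second_moment \<mu> + 2 * second_moment \<nu>"
proof -
  have plan: "\<mu> \<Otimes>\<^sub>M \<nu> \<in> transport_plans \<mu> \<nu>"
    using assms by (intro pair_measure_transport_plan) (auto dest: P2D)
  note [measurable_cong] = transport_planD(2)[OF plan]
  have "transport_cost \<mu> \<nu> \<le> (\<integral>\<^sup>+ z. ennreal ((dist (fst z) (snd z))\<^sup>2) \<partial>(\<mu> \<Otimes>\<^sub>M \<nu>))"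
    by (rule transport_cost_le[OF plan])
  also have "\<dots> \<le> (\<integral>\<^sup>+ z. 2 * ennreal ((norm (fst z))\<^sup>2) + 2 * ennreal ((norm (snd z))\<^sup>2) \<partial>(\<mu> \<Otimes>\<^sub>M \<nu>))"
    using dist_sq_le
    by (intro nn_integral_mono) (simp add: ennreal_mult''[symmetric] ennreal_plus[symmetric] del: ennreal_plus flip: ennreal_numeral)
  also have "\<dots> = 2 * second_moment \<mu> + 2 * second_moment \<nu>"
    using nn_integral_transport_plan[OF plan, of "\<lambda>x. ennreal ((norm x)\<^sup>2)"]
    by (simp add: nn_integral_add nn_integral_cmult second_moment_def)
  finally show ?thesis .
qed

lemma transport_cost_finite:
  assumes "\<mu> \<in> P2" "\<nu> \<in> P2"
  shows "transport_cost \<mu> \<nu> < \<infinity>"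
  using transport_cost_le_second_moment[OF assms] P2D(3)[OF assms(1)] P2D(3)[OF assms(2)]
  by (auto simp: ennreal_mult_eq_top_iff less_top[symmetric] top_unique)

text \<open>Stands in for the existence of an optimal plan: an estimate that is affine in the cost
  of an arbitrary plan passes to the infimum. Finiteness of the infimum is what makes a plan with
  cost strictly below infimum plus error available.\<close>

lemma le_affine_transport_cost:
  assumes fin: "transport_cost \<mu> \<nu> < \<infinity>" and "0 \<le> a"
    and le: "\<And>\<gamma>. \<gamma> \<in> transport_plans \<mu> \<nu> \<Longrightarrow>
      X \<le> ennreal a * (\<integral>\<^sup>+ z. ennreal ((dist (fst z) (snd z))\<^sup>2) \<partial>\<gamma>) + b"
  shows "X \<le> ennreal a * transport_cost \<mu> \<nu> + b"
proof (rule ennreal_le_epsilon)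
  fix e :: real assume "0 < e"
  \<comment> \<open>Dividing by \<open>a + 1\<close> rather than \<open>a\<close> covers
    \<open>a = 0\<close> and still keeps the final error at most \<open>e\<close>.\<close>
  then have "0 < e / (a + 1)"
    using \<open>0 \<le> a\<close> by simp
  then have "transport_cost \<mu> \<nu> < transport_cost \<mu> \<nu> + ennreal (e / (a + 1))"
    using fin by (metis ennreal_add_left_cancel_less add.right_neutral ennreal_less_zero_iff infinity_ennreal_def)
  then obtain \<gamma> where \<gamma>: "\<gamma> \<in> transport_plans \<mu> \<nu>"
    and less: "(\<integral>\<^sup>+ z. ennreal ((dist (fst z) (snd z))\<^sup>2) \<partial>\<gamma>) < transport_cost \<mu> \<nu> + ennreal (e / (a + 1))"
    by (subst (asm) (1) transport_cost_def) (auto simp: INF_less_iff)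
  have "X \<le> ennreal a * (\<integral>\<^sup>+ z. ennreal ((dist (fst z) (snd z))\<^sup>2) \<partial>\<gamma>) + b"
    using \<gamma> by (rule le)
  also have "\<dots> \<le> ennreal a * (transport_cost \<mu> \<nu> + ennreal (e / (a + 1))) + b"
    using less by (intro add_mono mult_left_mono) auto
  also have "\<dots> = ennreal a * transport_cost \<mu> \<nu> + b + ennreal (a * (e / (a + 1)))"
    using \<open>0 \<le> a\<close> \<open>0 < e / (a + 1)\<close>
    by (simp add: distrib_left ac_simps flip: ennreal_mult times_divide_eq_right)
  also have "\<dots> \<le> ennreal a * transport_cost \<mu> \<nu> + b + ennreal e"
    using \<open>0 \<le> a\<close> \<open>0 < e\<close> by (intro add_left_mono ennreal_leI) (simp add: field_simps)
  finally show "X \<le> ennreal a * transport_cost \<mu> \<nu> + b + ennreal e" .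
qed

lemma W2_sq:
  assumes "\<mu> \<in> P2" "\<nu> \<in> P2"
  shows "ennreal ((W2 \<mu> \<nu>)\<^sup>2) = transport_cost \<mu> \<nu>"
  using transport_cost_finite[OF assms]
  by (simp add: W2_def transport_cost_def[symmetric])

lemma W2_nonneg [simp]: "0 \<le> W2 \<mu> \<nu>"
  by (simp add: W2_def)

text \<open>Converse in spirit to \<open>transport_cost_le_second_moment\<close>: a bound on the
  cost to a fixed measure bounds the moment. Averaged over \<open>P\<close>, this is the source of
  coercivity.\<close>

lemma second_moment_le_transport_cost:
  assumes "\<mu> \<in> P2" "\<nu> \<in> P2"
  shows "second_moment \<mu> \<le> 2 * transport_cost \<mu> \<nu> + 2 * second_moment \<nu>"
proof -
  have "second_moment \<mu> \<le> 2 * (\<integral>\<^sup>+ z. ennreal ((dist (fst z) (snd z))\<^sup>2) \<partial>\<gamma>) + 2 * second_moment \<nu>"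
    if plan: "\<gamma> \<in> transport_plans \<mu> \<nu>" for \<gamma>
  proof -
    note [measurable_cong] = transport_planD(2)[OF plan]
    have "second_moment \<mu> = (\<integral>\<^sup>+ z. ennreal ((norm (fst z))\<^sup>2) \<partial>\<gamma>)"
      using nn_integral_transport_plan[OF plan, of "\<lambda>x. ennreal ((norm x)\<^sup>2)"]
      by (simp add: second_moment_def)
    also have "\<dots> \<le> (\<integral>\<^sup>+ z. 2 * ennreal ((dist (fst z) (snd z))\<^sup>2) + 2 * ennreal ((norm (snd z))\<^sup>2) \<partial>\<gamma>)"
      using norm_sq_le
      by (intro nn_integral_mono) (simp add: ennreal_mult''[symmetric] ennreal_plus[symmetric] del: ennreal_plus flip: ennreal_numeral)
    also have "\<dots> = 2 * (\<integral>\<^sup>+ z. ennreal ((dist (fst z) (snd z))\<^sup>2) \<partial>\<gamma>) + 2 * second_moment \<nu>"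
      using nn_integral_transport_plan[OF plan, of "\<lambda>x. ennreal ((norm x)\<^sup>2)"]
      by (simp add: nn_integral_add nn_integral_cmult second_moment_def)
    finally show ?thesis .
  qed
  then show ?thesis
    using le_affine_transport_cost[OF transport_cost_finite[OF assms], of 2] by simp
qed

subsection \<open>Glueing and measurability\<close>

text \<open>\<open>k1\<close> and \<open>k2\<close> are cell labels with the same law
  \<open>a\<close>. Given a point in a cell of positive mass, the weight \<open>1 / a\<close> on the
  matching cell integrates to 1. Cells of mass 0 are null; there \<open>inverse 0 = top\<close>
  multiplies a null set and the integral is 0, so the claim can hold only almost everywhere.\<close>

lemma AE_nn_integral_glue:
  fixes k1 :: "'a \<Rightarrow> nat" and k2 :: "'b \<Rightarrow> nat" and a :: "nat \<Rightarrow> ennreal"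
  assumes "prob_space M1"
    and [measurable]: "k1 \<in> measurable M1 (count_space UNIV)" "k2 \<in> measurable M2 (count_space UNIV)"
    and a1: "\<And>n. emeasure M1 {x \<in> space M1. k1 x = n} = a n"
    and a2: "\<And>n. emeasure M2 {y \<in> space M2. k2 y = n} = a n"
  shows "AE x in M1. (\<integral>\<^sup>+y. (if k1 x = k2 y then inverse (a (k1 x)) else 0) \<partial>M2) = 1"
proof -
  interpret M1: prob_space M1 by fact
  have "AE x in M1. a n = 0 \<longrightarrow> k1 x \<noteq> n" for n
  proof (cases "a n = 0")
    case True
    then have "{x \<in> space M1. k1 x = n} \<in> null_sets M1"
      using a1[of n] by (intro null_setsI) auto
    then show ?thesis
      by (rule AE_I') auto
  qed simp
  then have "AE x in M1. \<forall>n. a n = 0 \<longrightarrow> k1 x \<noteq> n"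
    by (simp add: AE_all_countable)
  then show ?thesis
  proof eventually_elim
    case (elim x)
    then have "a (k1 x) \<noteq> 0"
      by blast
    have "a (k1 x) \<le> 1"
      unfolding a1[symmetric] by (rule M1.measure_le_1)
    then have "a (k1 x) \<noteq> top"
      by (auto simp: top_unique)
    have "(\<integral>\<^sup>+y. (if k1 x = k2 y then inverse (a (k1 x)) else 0) \<partial>M2) =
        (\<integral>\<^sup>+y. inverse (a (k1 x)) * indicator {y \<in> space M2. k2 y = k1 x} y \<partial>M2)"
      by (intro nn_integral_cong) (auto simp: indicator_def)
    also have "\<dots> = inverse (a (k1 x)) * a (k1 x)"
      by (subst nn_integral_cmult_indicator) (auto simp: a2)
    also have "\<dots> = 1"
      using \<open>a (k1 x) \<noteq> 0\<close> \<open>a (k1 x) \<noteq> top\<close>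
      by (simp add: mult.commute[of "inverse _"] divide_ennreal_def[symmetric] ennreal_divide_self less_top[symmetric])
    finally show ?case .
  qed
qed

text \<open>The label of a point is the first index in an enumeration of a countable dense set whose
  member lies within \<open>h / 2\<close>; two points with the same label share that member.\<close>

lemma ex_small_partition:
  assumes "0 < h"
  obtains q :: "'a::euclidean_space \<Rightarrow> nat"
    where "q \<in> measurable borel (count_space UNIV)" "\<And>x y. q x = q y \<Longrightarrow> dist x y \<le> h"
proof -
  obtain D :: "'a set" where D: "countable D" "\<And>X. open X \<Longrightarrow> X \<noteq> {} \<Longrightarrow> \<exists>d\<in>D. d \<in> X"
    using countable_dense_exists by blast
  then have "D \<noteq> {}"
    using open_UNIV by blast
  define q where "q x = (LEAST n. dist (from_nat_into D n) x < h / 2)" for x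
  have ex: "\<exists>n. dist (from_nat_into D n) x < h / 2" for x
  proof -
    obtain d where "d \<in> D" "d \<in> ball x (h / 2)"
      using D(2)[of "ball x (h / 2)"] assms by auto
    then show ?thesis
      using from_nat_into_surj[OF D(1)] by (metis dist_commute mem_ball)
  qed
  have q: "dist (from_nat_into D (q x)) x < h / 2" for x
    unfolding q_def using ex by (rule LeastI_ex)
  show thesis
  proof
    show "q \<in> measurable borel (count_space UNIV)"
      unfolding q_def by measurable
    fix x y assume "q x = q y"
    then show "dist x y \<le> h"
      using q[of x] q[of y] dist_triangle2[of x y "from_nat_into D (q x)"]
      by (simp add: dist_commute)
  qed
qed

text \<open>Young's inequality with a weight: the coefficient of one square may be brought as close
  to 1 as desired, which neither openness of balls nor conservation of mass could do
  without.\<close>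

lemma square_sum_le:
  fixes a b s :: real
  assumes "0 < s"
  shows "(a + b)\<^sup>2 \<le> (1 + s) * a\<^sup>2 + (1 + 1 / s) * b\<^sup>2"
proof -
  have "(1 + s) * a\<^sup>2 + (1 + 1 / s) * b\<^sup>2 - (a + b)\<^sup>2 = (s * a - b)\<^sup>2 / s"
    using assms by (simp add: field_simps power2_eq_square)
  then show ?thesis
    using assms by (metis diff_ge_0_iff_ge divide_nonneg_pos zero_le_power2)
qed

text \<open>A glueing argument without disintegration: the middle variables \<open>y\<close> and \<open>y'\<close> are only
  identified up to a countable partition of mesh \<open>h\<close>, conditionally on whose cells the two plans
  are joined independently.\<close>

lemma transport_plan_approx_glue:
  fixes \<mu> \<nu> \<xi> :: "'a::euclidean_space measure"
  assumes \<gamma>1: "\<gamma>1 \<in> transport_plans \<mu> \<nu>" and \<gamma>2: "\<gamma>2 \<in> transport_plans \<nu> \<xi>"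
    and "0 < s" "0 < h"
  shows "transport_cost \<mu> \<xi> \<le>
    ennreal (1 + s) * (\<integral>\<^sup>+ z. ennreal ((dist (fst z) (snd z))\<^sup>2) \<partial>\<gamma>1) +
    ennreal (2 * (1 + 1 / s)) * (\<integral>\<^sup>+ z. ennreal ((dist (fst z) (snd z))\<^sup>2) \<partial>\<gamma>2) +
    ennreal (2 * (1 + 1 / s) * h\<^sup>2)"
proof -
  define A B where "A = 1 + s" and "B = 2 * (1 + 1 / s)"
  have "0 \<le> A" "0 \<le> B"
    using \<open>0 < s\<close> by (simp_all add: A_def B_def)
  obtain q :: "'a \<Rightarrow> nat" where [measurable]: "q \<in> measurable borel (count_space UNIV)"
    and q: "\<And>x y. q x = q y \<Longrightarrow> dist x y \<le> h"
    using ex_small_partition[OF \<open>0 < h\<close>] by blast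
  interpret G1: prob_space \<gamma>1 by (rule transport_planD[OF \<gamma>1])
  interpret G2: prob_space \<gamma>2 by (rule transport_planD[OF \<gamma>2])
  interpret pair_sigma_finite \<gamma>1 \<gamma>2 ..
  note [measurable_cong] = transport_planD(2)[OF \<gamma>1] transport_planD(2)[OF \<gamma>2]
  define a where "a n = emeasure \<nu> {y. q y = n}" for n
  have a1: "emeasure \<gamma>1 {p \<in> space \<gamma>1. q (snd p) = n} = a n" for n
  proof -
    have "emeasure (distr \<gamma>1 borel snd) {y. q y = n} = emeasure \<gamma>1 {p \<in> space \<gamma>1. q (snd p) = n}"
      by (subst emeasure_distr) (auto intro!: arg_cong[where f="emeasure \<gamma>1"])
    then show ?thesis
      by (simp add: a_def transport_planD(4)[OF \<gamma>1])
  qed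
  have a2: "emeasure \<gamma>2 {p \<in> space \<gamma>2. q (fst p) = n} = a n" for n
  proof -
    have "emeasure (distr \<gamma>2 borel fst) {y. q y = n} = emeasure \<gamma>2 {p \<in> space \<gamma>2. q (fst p) = n}"
      by (subst emeasure_distr) (auto intro!: arg_cong[where f="emeasure \<gamma>2"])
    then show ?thesis
      by (simp add: a_def transport_planD(3)[OF \<gamma>2])
  qed
  have ae1: "AE p in \<gamma>1. (\<integral>\<^sup>+p'. (if q (snd p) = q (fst p') then inverse (a (q (snd p))) else 0) \<partial>\<gamma>2) = 1"
    by (rule AE_nn_integral_glue[OF _ _ _ a1 a2]) (auto intro: G1.prob_space_axioms)
  have ae2: "AE p' in \<gamma>2. (\<integral>\<^sup>+p. (if q (fst p') = q (snd p) then inverse (a (q (fst p'))) else 0) \<partial>\<gamma>1) = 1"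
    by (rule AE_nn_integral_glue[OF _ _ _ a2 a1]) (auto intro: G2.prob_space_axioms)
  \<comment> \<open>Density of the glued law with respect to the independent product: only pairs
    whose middle points share a cell survive, normalised by the mass of that cell.\<close>
  define w where "w p p' = (if q (snd p) = q (fst p') then inverse (a (q (snd p))) else 0)"
    for p p' :: "'a \<times> 'a"
  have w_sym: "w p p' = (if q (fst p') = q (snd p) then inverse (a (q (fst p'))) else 0)" for p p'
    by (simp add: w_def)
  \<comment> \<open>Equality of two labels is written as a countable union over their common value,
    which is visibly measurable.\<close>
  have "Measurable.pred (\<gamma>1 \<Otimes>\<^sub>M \<gamma>2) (\<lambda>z. \<exists>n. q (fst (snd z)) = n \<and> q (snd (fst z)) = n)"
    by measurable
  then have [measurable]: "Measurable.pred (\<gamma>1 \<Otimes>\<^sub>M \<gamma>2) (\<lambda>z. q (snd (fst z)) = q (fst (snd z)))"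
    by simp
  have [measurable]: "(\<lambda>z. w (fst z) (snd z)) \<in> borel_measurable (\<gamma>1 \<Otimes>\<^sub>M \<gamma>2)"
    unfolding w_def by measurable
  have [measurable]: "w p \<in> borel_measurable \<gamma>2" "(\<lambda>p. w p p') \<in> borel_measurable \<gamma>1" for p p'
    unfolding w_def by measurable
  define \<Gamma> where "\<Gamma> = density (\<gamma>1 \<Otimes>\<^sub>M \<gamma>2) (\<lambda>z. w (fst z) (snd z))"
  have [measurable_cong]: "sets \<Gamma> = sets (\<gamma>1 \<Otimes>\<^sub>M \<gamma>2)"
    by (simp add: \<Gamma>_def)
  have marg1: "(\<integral>\<^sup>+z. g (fst z) \<partial>\<Gamma>) = (\<integral>\<^sup>+p. g p \<partial>\<gamma>1)"
    if [measurable]: "g \<in> borel_measurable \<gamma>1" for g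
  proof -
    have "(\<integral>\<^sup>+z. g (fst z) \<partial>\<Gamma>) = (\<integral>\<^sup>+z. w (fst z) (snd z) * g (fst z) \<partial>(\<gamma>1 \<Otimes>\<^sub>M \<gamma>2))"
      unfolding \<Gamma>_def by (rule nn_integral_density) auto
    also have "\<dots> = (\<integral>\<^sup>+p. (\<integral>\<^sup>+p'. w p p' * g p \<partial>\<gamma>2) \<partial>\<gamma>1)"
      by (subst G2.nn_integral_fst[symmetric]) auto
    also have "\<dots> = (\<integral>\<^sup>+p. g p \<partial>\<gamma>1)"
      using ae1 unfolding w_def[symmetric]
      by (intro nn_integral_cong_AE) (auto simp: nn_integral_multc elim: eventually_mono)
    finally show ?thesis .
  qed
  have marg2: "(\<integral>\<^sup>+z. g (snd z) \<partial>\<Gamma>) = (\<integral>\<^sup>+p. g p \<partial>\<gamma>2)"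
    if [measurable]: "g \<in> borel_measurable \<gamma>2" for g
  proof -
    have "(\<integral>\<^sup>+z. g (snd z) \<partial>\<Gamma>) = (\<integral>\<^sup>+z. w (fst z) (snd z) * g (snd z) \<partial>(\<gamma>1 \<Otimes>\<^sub>M \<gamma>2))"
      unfolding \<Gamma>_def by (rule nn_integral_density) auto
    also have "\<dots> = (\<integral>\<^sup>+p'. (\<integral>\<^sup>+p. w p p' * g p' \<partial>\<gamma>1) \<partial>\<gamma>2)"
      by (subst nn_integral_snd[symmetric]) auto
    also have "\<dots> = (\<integral>\<^sup>+p. g p \<partial>\<gamma>2)"
      using ae2 unfolding w_sym[symmetric]
      by (intro nn_integral_cong_AE) (auto simp: nn_integral_multc elim: eventually_mono)
    finally show ?thesis .
  qed
  \<comment> \<open>Forgetting both middle points leaves a plan between the outer measures.\<close>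
  define \<gamma> where "\<gamma> = distr \<Gamma> (borel \<Otimes>\<^sub>M borel) (\<lambda>z. (fst (fst z), snd (snd z)))"
  have "\<gamma> \<in> transport_plans \<mu> \<xi>"
  proof (rule transport_planI)
    show "prob_space \<mu>"
      using G1.prob_space_distr[of fst borel] transport_planD(3)[OF \<gamma>1] by simp
    show "sets \<mu> = sets borel" "sets \<xi> = sets borel"
      unfolding transport_planD(3)[OF \<gamma>1, symmetric] transport_planD(4)[OF \<gamma>2, symmetric] by auto
    fix A :: "'a set" assume [measurable]: "A \<in> sets borel"
    have "(\<integral>\<^sup>+ z. indicator A (fst z) \<partial>\<gamma>) = (\<integral>\<^sup>+ z. indicator A (fst (fst z)) \<partial>\<Gamma>)"
      unfolding \<gamma>_def by (subst nn_integral_distr) auto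
    also have "\<dots> = (\<integral>\<^sup>+ z. indicator A (fst z) \<partial>\<gamma>1)"
      by (rule marg1) auto
    also have "\<dots> = (\<integral>\<^sup>+ x. indicator A x \<partial>\<mu>)"
      by (rule nn_integral_transport_plan[OF \<gamma>1]) auto
    also have "\<dots> = emeasure \<mu> A"
      using \<open>sets \<mu> = sets borel\<close> by simp
    finally show "(\<integral>\<^sup>+ z. indicator A (fst z) \<partial>\<gamma>) = emeasure \<mu> A" .
    have "(\<integral>\<^sup>+ z. indicator A (snd z) \<partial>\<gamma>) = (\<integral>\<^sup>+ z. indicator A (snd (snd z)) \<partial>\<Gamma>)"
      unfolding \<gamma>_def by (subst nn_integral_distr) auto
    also have "\<dots> = (\<integral>\<^sup>+ z. indicator A (snd z) \<partial>\<gamma>2)"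
      by (rule marg2) auto
    also have "\<dots> = (\<integral>\<^sup>+ x. indicator A x \<partial>\<xi>)"
      by (rule nn_integral_transport_plan[OF \<gamma>2]) auto
    also have "\<dots> = emeasure \<xi> A"
      using \<open>sets \<xi> = sets borel\<close> by simp
    finally show "(\<integral>\<^sup>+ z. indicator A (snd z) \<partial>\<gamma>) = emeasure \<xi> A" .
  qed (simp add: \<gamma>_def)
  then have "transport_cost \<mu> \<xi> \<le> (\<integral>\<^sup>+ z. ennreal ((dist (fst z) (snd z))\<^sup>2) \<partial>\<gamma>)"
    by (rule transport_cost_le)
  also have "\<dots> = (\<integral>\<^sup>+ z. ennreal ((dist (fst (fst z)) (snd (snd z)))\<^sup>2) \<partial>\<Gamma>)"
    unfolding \<gamma>_def by (subst nn_integral_distr) auto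
  also have "\<dots> = (\<integral>\<^sup>+ z. w (fst z) (snd z) * ennreal ((dist (fst (fst z)) (snd (snd z)))\<^sup>2) \<partial>(\<gamma>1 \<Otimes>\<^sub>M \<gamma>2))"
    unfolding \<Gamma>_def by (rule nn_integral_density) auto
  also have "\<dots> \<le> (\<integral>\<^sup>+ z. w (fst z) (snd z) *
      (ennreal A * ennreal ((dist (fst (fst z)) (snd (fst z)))\<^sup>2) +
       ennreal (B) * ennreal ((dist (fst (snd z)) (snd (snd z)))\<^sup>2) +
       ennreal (B * h\<^sup>2)) \<partial>(\<gamma>1 \<Otimes>\<^sub>M \<gamma>2))"
  proof (rule nn_integral_mono)
    fix z :: "('a \<times> 'a) \<times> ('a \<times> 'a)"
    obtain x y y' x' where z: "z = ((x, y), (y', x'))"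
      by (metis surj_pair)
    \<comment> \<open>The weight \<open>w\<close> vanishes off matching cells, so only here is a
      bound required, and here the two middle points are within \<open>h\<close>. The factor 2 in
      \<open>B\<close> comes from separating \<open>dist y' x'\<close> from this
      \<open>h\<close>.\<close>
    have "(dist x x')\<^sup>2 \<le> A * (dist x y)\<^sup>2 + B * (dist y' x')\<^sup>2 + B * h\<^sup>2"
      if "q y = q y'"
    proof -
      have "dist x x' \<le> dist x y + (dist y' x' + h)"
        using q[OF that] dist_triangle[of x x' y] dist_triangle[of y x' y'] by simp
      then have "(dist x x')\<^sup>2 \<le> (dist x y + (dist y' x' + h))\<^sup>2"
        by (rule power_mono) simp
      also have "\<dots> \<le> (1 + s) * (dist x y)\<^sup>2 + (1 + 1 / s) * (dist y' x' + h)\<^sup>2"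
        by (rule square_sum_le[OF \<open>0 < s\<close>])
      also have "\<dots> \<le> (1 + s) * (dist x y)\<^sup>2 + (1 + 1 / s) * (2 * (dist y' x')\<^sup>2 + 2 * h\<^sup>2)"
        using square_sum_le[of 1 "dist y' x'" h] \<open>0 < s\<close>
        by (intro add_left_mono mult_left_mono) auto
      also have "\<dots> = A * (dist x y)\<^sup>2 + B * (dist y' x')\<^sup>2 + B * h\<^sup>2"
        unfolding A_def B_def by algebra
      finally show ?thesis .
    qed
    then have "ennreal ((dist x x')\<^sup>2) \<le> ennreal A * ennreal ((dist x y)\<^sup>2) +
       ennreal (B) * ennreal ((dist y' x')\<^sup>2) + ennreal (B * h\<^sup>2)"
      if "q y = q y'"
      using that \<open>0 \<le> A\<close> \<open>0 \<le> B\<close> by (simp flip: ennreal_mult ennreal_plus)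
    then show "w (fst z) (snd z) * ennreal ((dist (fst (fst z)) (snd (snd z)))\<^sup>2) \<le>
      w (fst z) (snd z) *
      (ennreal A * ennreal ((dist (fst (fst z)) (snd (fst z)))\<^sup>2) +
       ennreal (B) * ennreal ((dist (fst (snd z)) (snd (snd z)))\<^sup>2) +
       ennreal (B * h\<^sup>2))"
      by (auto simp: z w_def intro!: mult_left_mono)
  qed
  also have "\<dots> = (\<integral>\<^sup>+ z.
      ennreal A * ennreal ((dist (fst (fst z)) (snd (fst z)))\<^sup>2) +
       ennreal (B) * ennreal ((dist (fst (snd z)) (snd (snd z)))\<^sup>2) +
       ennreal (B * h\<^sup>2) \<partial>\<Gamma>)"
    unfolding \<Gamma>_def by (rule nn_integral_density[symmetric]) auto
  also have "\<dots> = ennreal A * (\<integral>\<^sup>+ z. ennreal ((dist (fst (fst z)) (snd (fst z)))\<^sup>2) \<partial>\<Gamma>) +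
      ennreal (B) * (\<integral>\<^sup>+ z. ennreal ((dist (fst (snd z)) (snd (snd z)))\<^sup>2) \<partial>\<Gamma>) +
      ennreal (B * h\<^sup>2) * (\<integral>\<^sup>+ z. 1 \<partial>\<Gamma>)"
    by (simp add: nn_integral_add nn_integral_cmult del: ennreal_plus)
  also have "(\<integral>\<^sup>+ z. 1 \<partial>\<Gamma>) = 1"
    using marg1[of "\<lambda>_. 1"] G1.emeasure_space_1 by simp
  finally show ?thesis
    unfolding A_def B_def using marg1[of "\<lambda>z. ennreal ((dist (fst z) (snd z))\<^sup>2)"]
      marg2[of "\<lambda>z. ennreal ((dist (fst z) (snd z))\<^sup>2)"] by simp
qed

lemma transport_cost_triangle:
  fixes \<mu> \<nu> \<xi> :: "'a::euclidean_space measure"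
  assumes "\<mu> \<in> P2" "\<nu> \<in> P2" "\<xi> \<in> P2" "0 < s"
  shows "transport_cost \<mu> \<xi> \<le>
    ennreal (1 + s) * transport_cost \<mu> \<nu> + ennreal (2 * (1 + 1 / s)) * transport_cost \<nu> \<xi>"
proof (rule ennreal_le_epsilon)
  fix e :: real assume "0 < e"
  \<comment> \<open>The mesh is chosen so that the discretisation error of the glueing is exactly
    \<open>e\<close>, whatever the two plans are.\<close>
  define h where "h = sqrt (e / (2 * (1 + 1 / s)))"
  have "0 < 2 * (1 + 1 / s)"
    using \<open>0 < s\<close> by (simp add: add_pos_pos)
  then have h: "0 < h" "2 * (1 + 1 / s) * h\<^sup>2 = e"
    using \<open>0 < e\<close> by (simp_all add: h_def)
  have "transport_cost \<mu> \<xi> \<le> ennreal (1 + s) * (\<integral>\<^sup>+ z. ennreal ((dist (fst z) (snd z))\<^sup>2) \<partial>\<gamma>1) +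
      (ennreal (2 * (1 + 1 / s)) * transport_cost \<nu> \<xi> + ennreal e)"
    if "\<gamma>1 \<in> transport_plans \<mu> \<nu>" for \<gamma>1
  proof -
    have "transport_cost \<mu> \<xi> \<le> ennreal (2 * (1 + 1 / s)) * transport_cost \<nu> \<xi> +
      (ennreal (1 + s) * (\<integral>\<^sup>+ z. ennreal ((dist (fst z) (snd z))\<^sup>2) \<partial>\<gamma>1) + ennreal e)"
      using transport_plan_approx_glue[OF that _ \<open>0 < s\<close> \<open>0 < h\<close>] \<open>0 < 2 * (1 + 1 / s)\<close> unfolding h(2)
      by (intro le_affine_transport_cost transport_cost_finite assms) (auto simp: ac_simps)
    then show ?thesis
      by (simp add: ac_simps)
  qed
  then have "transport_cost \<mu> \<xi> \<le> ennreal (1 + s) * transport_cost \<mu> \<nu> +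
      (ennreal (2 * (1 + 1 / s)) * transport_cost \<nu> \<xi> + ennreal e)"
    using \<open>0 < s\<close> by (intro le_affine_transport_cost transport_cost_finite assms) auto
  then show "transport_cost \<mu> \<xi> \<le> ennreal (1 + s) * transport_cost \<mu> \<nu> +
      ennreal (2 * (1 + 1 / s)) * transport_cost \<nu> \<xi> + ennreal e"
    by (simp add: ac_simps)
qed

lemma W2_sq_triangle:
  assumes "\<mu> \<in> P2" "\<nu> \<in> P2" "\<xi> \<in> P2" "0 < s"
  shows "(W2 \<mu> \<xi>)\<^sup>2 \<le> (1 + s) * (W2 \<mu> \<nu>)\<^sup>2 + 2 * (1 + 1 / s) * (W2 \<nu> \<xi>)\<^sup>2"
proof -
  have "ennreal ((W2 \<mu> \<xi>)\<^sup>2) \<le> ennreal (1 + s) * ennreal ((W2 \<mu> \<nu>)\<^sup>2) + ennreal (2 * (1 + 1 / s)) * ennreal ((W2 \<nu> \<xi>)\<^sup>2)"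
    using transport_cost_triangle[OF assms] assms by (simp add: W2_sq)
  also have "\<dots> = ennreal ((1 + s) * (W2 \<mu> \<nu>)\<^sup>2 + 2 * (1 + 1 / s) * (W2 \<nu> \<xi>)\<^sup>2)"
    using \<open>0 < s\<close> by (simp flip: ennreal_mult ennreal_plus)
  finally show ?thesis
    using \<open>0 < s\<close> by (subst (asm) ennreal_le_iff) auto
qed

section \<open>Measurability of the distance and of the second moment\<close>

lemma space_borel_P2: "space borel_P2 = P2"
  unfolding borel_P2_def by (rule space_measure_of) auto

lemma sets_borel_P2:
  "sets borel_P2 = sigma_sets P2 {U. U \<subseteq> P2 \<and> (\<forall>\<mu>\<in>U. \<exists>\<epsilon>>0. \<forall>\<nu>\<in>P2. W2 \<mu> \<nu> < \<epsilon> \<longrightarrow> \<nu> \<in> U)}"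
  unfolding borel_P2_def by (rule sets_measure_of) auto

text \<open>The sublevel set of \<open>W2 \<mu>\<close> is one of the generating open sets. The
  relaxed triangle inequality suffices because \<open>s\<close> may depend on the slack at the given
  point \<open>\<nu>\<close>.\<close>

lemma borel_measurable_W2:
  fixes \<mu> :: "'a::euclidean_space measure"
  assumes "\<mu> \<in> P2"
  shows "W2 \<mu> \<in> borel_measurable borel_P2"
  unfolding borel_measurable_iff_less
proof
  fix c :: real
  have "\<exists>\<epsilon>>0. \<forall>\<xi>\<in>P2. W2 \<nu> \<xi> < \<epsilon> \<longrightarrow> W2 \<mu> \<xi> < c" if "\<nu> \<in> P2" "W2 \<mu> \<nu> < c" for \<nu>
  proof -
    have "0 < c"
      using that(2) W2_nonneg[of \<mu> \<nu>] by linarith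
    have less: "(W2 \<mu> \<nu>)\<^sup>2 < c\<^sup>2"
      using that(2) by (intro power_strict_mono) auto
    \<comment> \<open>Half of the slack in the squares: one half pays for the factor
      \<open>1 + s\<close>, the other for the term in \<open>W2 \<nu> \<xi>\<close>.\<close>
    define d where "d = (c\<^sup>2 - (W2 \<mu> \<nu>)\<^sup>2) / 2"
    have "0 < d"
      using less by (simp add: d_def)
    define s where "s = d / c\<^sup>2"
    have s: "0 < s" "s * c\<^sup>2 = d"
      using \<open>0 < d\<close> \<open>0 < c\<close> by (simp_all add: s_def)
    define \<epsilon> where "\<epsilon> = sqrt (d / (2 * (1 + 1 / s)))"
    have pos: "0 < 2 * (1 + 1 / s)"
      using \<open>0 < s\<close> by (simp add: add_pos_pos)
    then have "0 < \<epsilon>" and \<epsilon>: "2 * (1 + 1 / s) * \<epsilon>\<^sup>2 = d"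
      using \<open>0 < d\<close> by (simp_all add: \<epsilon>_def)
    have "W2 \<mu> \<xi> < c" if "\<xi> \<in> P2" "W2 \<nu> \<xi> < \<epsilon>" for \<xi>
    proof -
      have "(W2 \<nu> \<xi>)\<^sup>2 < \<epsilon>\<^sup>2"
        using that(2) by (intro power_strict_mono) auto
      then have "2 * (1 + 1 / s) * (W2 \<nu> \<xi>)\<^sup>2 < d"
        unfolding \<epsilon>[symmetric] using pos by (rule mult_strict_left_mono)
      moreover have "s * (W2 \<mu> \<nu>)\<^sup>2 \<le> d"
        unfolding s(2)[symmetric] using less s(1) by (intro mult_left_mono) auto
      moreover have "(W2 \<mu> \<xi>)\<^sup>2 \<le> (1 + s) * (W2 \<mu> \<nu>)\<^sup>2 + 2 * (1 + 1 / s) * (W2 \<nu> \<xi>)\<^sup>2"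
        by (rule W2_sq_triangle) fact+
      moreover have "(1 + s) * (W2 \<mu> \<nu>)\<^sup>2 = (W2 \<mu> \<nu>)\<^sup>2 + s * (W2 \<mu> \<nu>)\<^sup>2"
        by (simp add: algebra_simps)
      moreover have "2 * d = c\<^sup>2 - (W2 \<mu> \<nu>)\<^sup>2"
        by (simp add: d_def)
      ultimately have "(W2 \<mu> \<xi>)\<^sup>2 < c\<^sup>2"
        by linarith
      then show ?thesis
        using \<open>0 < c\<close> by (simp add: power2_less_imp_less)
    qed
    with \<open>0 < \<epsilon>\<close> show ?thesis
      by blast
  qed
  then show "{\<nu> \<in> space borel_P2. W2 \<mu> \<nu> < c} \<in> sets borel_P2"
    unfolding sets_borel_P2 space_borel_P2 by (intro sigma_sets.Basic) blast
qed

lemma return_0_P2: "return borel 0 \<in> P2"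
  by (auto simp: P2_def second_moment_def nn_integral_return intro!: prob_space_return)

text \<open>Every plan from the Dirac mass is concentrated on pairs with first entry 0, so all plans
  cost the same. This exhibits \<open>second_moment\<close> as a squared distance and hence as a
  Borel function on \<open>P2\<close>.\<close>

lemma transport_cost_return_0:
  assumes "\<nu> \<in> P2"
  shows "transport_cost (return borel 0) \<nu> = second_moment \<nu>"
proof -
  have "(\<integral>\<^sup>+ z. ennreal ((dist (fst z) (snd z))\<^sup>2) \<partial>\<gamma>) = second_moment \<nu>"
    if plan: "\<gamma> \<in> transport_plans (return borel 0) \<nu>" for \<gamma>
  proof -
    note [measurable_cong] = transport_planD(2)[OF plan]
    have "AE x in distr \<gamma> borel fst. x = 0"
      unfolding transport_planD(3)[OF plan] by (subst AE_return) auto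
    then have "AE z in \<gamma>. fst z = 0"
      by (subst (asm) AE_distr_iff) auto
    then have "(\<integral>\<^sup>+ z. ennreal ((dist (fst z) (snd z))\<^sup>2) \<partial>\<gamma>) = (\<integral>\<^sup>+ z. ennreal ((norm (snd z))\<^sup>2) \<partial>\<gamma>)"
      by (intro nn_integral_cong_AE) (auto elim: eventually_mono)
    also have "\<dots> = second_moment \<nu>"
      unfolding second_moment_def by (rule nn_integral_transport_plan[OF plan]) auto
    finally show ?thesis .
  qed
  moreover have "transport_plans (return borel 0) \<nu> \<noteq> {}"
    using pair_measure_transport_plan[of "return borel 0" \<nu>] P2D[OF assms] P2D[OF return_0_P2] by blast
  ultimately show ?thesis
    by (simp add: transport_cost_def)
qed

lemma borel_measurable_second_moment: "second_moment \<in> borel_measurable borel_P2"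
proof -
  have "second_moment \<nu> = ennreal ((W2 (return borel 0) \<nu>)\<^sup>2)"
    if "\<nu> \<in> space borel_P2" for \<nu> :: "'a measure"
    using that by (simp add: space_borel_P2 W2_sq return_0_P2 transport_cost_return_0)
  moreover have "(\<lambda>\<nu>. ennreal ((W2 (return borel 0) \<nu>)\<^sup>2)) \<in> borel_measurable (borel_P2 :: 'a measure measure)"
    using borel_measurable_W2[OF return_0_P2] by measurable
  ultimately show ?thesis
    by (simp cong: measurable_cong)
qed

subsection \<open>Convexity and lower semicontinuity of the transport cost\<close>

lemma ennreal_half_add_half: "ennreal (1 / 2) * x + ennreal (1 / 2) * x = x"
proof -
  have "ennreal (1 / 2) + ennreal (1 / 2) = 1"
    by (subst ennreal_plus[symmetric]) simp_all
  then show ?thesis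
    by (metis distrib_right mult_1)
qed

text \<open>The half-sum of two plans to \<open>\<nu>\<close> is a plan for the midpoint, and cost
  is linear in the plan. The two infima are reached one at a time, by nesting
  \<open>le_affine_transport_cost\<close>.\<close>

lemma transport_cost_midpoint_le:
  assumes P2: "\<mu> \<in> P2" "\<mu>1 \<in> P2" "\<mu>2 \<in> P2" "\<nu> \<in> P2"
    and mid: "\<And>A. A \<in> sets borel \<Longrightarrow>
      emeasure \<mu> A = ennreal (1 / 2) * emeasure \<mu>1 A + ennreal (1 / 2) * emeasure \<mu>2 A"
  shows "transport_cost \<mu> \<nu> \<le>
    ennreal (1 / 2) * transport_cost \<mu>1 \<nu> + ennreal (1 / 2) * transport_cost \<mu>2 \<nu>"
proof (intro le_affine_transport_cost[OF transport_cost_finite] P2)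
  fix \<gamma>1 assume \<gamma>1: "\<gamma>1 \<in> transport_plans \<mu>1 \<nu>"
  let ?c = "\<lambda>z :: 'a \<times> 'a. ennreal ((dist (fst z) (snd z))\<^sup>2)"
  have "transport_cost \<mu> \<nu> \<le>
    ennreal (1 / 2) * transport_cost \<mu>2 \<nu> + ennreal (1 / 2) * (\<integral>\<^sup>+ z. ?c z \<partial>\<gamma>1)"
  proof (intro le_affine_transport_cost[OF transport_cost_finite] P2)
    fix \<gamma>2 assume \<gamma>2: "\<gamma>2 \<in> transport_plans \<mu>2 \<nu>"
    note [measurable_cong] = transport_planD(2)[OF \<gamma>1] transport_planD(2)[OF \<gamma>2]
    define \<gamma> where "\<gamma> = density (plus_measure \<gamma>1 \<gamma>2) (\<lambda>_. ennreal (1 / 2))"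
    have int: "(\<integral>\<^sup>+ z. h z \<partial>\<gamma>) =
        ennreal (1 / 2) * (\<integral>\<^sup>+ z. h z \<partial>\<gamma>1) + ennreal (1 / 2) * (\<integral>\<^sup>+ z. h z \<partial>\<gamma>2)"
      if [measurable]: "h \<in> borel_measurable (borel \<Otimes>\<^sub>M borel)" for h
      unfolding \<gamma>_def
      by (subst nn_integral_density, measurable, subst nn_integral_plus_measure)
        (auto simp: transport_planD(2)[OF \<gamma>1] transport_planD(2)[OF \<gamma>2] nn_integral_cmult)
    have "\<gamma> \<in> transport_plans \<mu> \<nu>"
    proof (rule transport_planI)
      show "sets \<gamma> = sets (borel \<Otimes>\<^sub>M borel)"
        by (simp add: \<gamma>_def transport_planD(2)[OF \<gamma>1])
      fix A :: "'a set" assume [measurable]: "A \<in> sets borel"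
      then have A: "A \<in> sets \<mu>1" "A \<in> sets \<mu>2" "A \<in> sets \<nu>"
        using P2 by (auto dest: P2D)
      show "(\<integral>\<^sup>+ z. indicator A (fst z) \<partial>\<gamma>) = emeasure \<mu> A"
        using nn_integral_transport_plan(1)[OF \<gamma>1, of "indicator A"]
          nn_integral_transport_plan(1)[OF \<gamma>2, of "indicator A"] A
        by (simp add: int mid)
      show "(\<integral>\<^sup>+ z. indicator A (snd z) \<partial>\<gamma>) = emeasure \<nu> A"
        using nn_integral_transport_plan(2)[OF \<gamma>1, of "indicator A"]
          nn_integral_transport_plan(2)[OF \<gamma>2, of "indicator A"] A
        by (simp add: int ennreal_half_add_half del: ennreal_half)
    qed (use P2 in \<open>auto dest: P2D\<close>)
    then have "transport_cost \<mu> \<nu> \<le> (\<integral>\<^sup>+ z. ?c z \<partial>\<gamma>)"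
      by (rule transport_cost_le)
    also have "\<dots> = ennreal (1 / 2) * (\<integral>\<^sup>+ z. ?c z \<partial>\<gamma>1) + ennreal (1 / 2) * (\<integral>\<^sup>+ z. ?c z \<partial>\<gamma>2)"
      by (rule int) auto
    finally show "transport_cost \<mu> \<nu> \<le>
        ennreal (1 / 2) * (\<integral>\<^sup>+ z. ?c z \<partial>\<gamma>2) + ennreal (1 / 2) * (\<integral>\<^sup>+ z. ?c z \<partial>\<gamma>1)"
      by (simp add: ac_simps)
  qed simp
  then show "transport_cost \<mu> \<nu> \<le>
      ennreal (1 / 2) * (\<integral>\<^sup>+ z. ?c z \<partial>\<gamma>1) + ennreal (1 / 2) * transport_cost \<mu>2 \<nu>"
    by (simp add: ac_simps)
qed simp

section \<open>Stability of the transport cost under a change of density\<close>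

lemma density_P2_iff:
  assumes [measurable]: "f \<in> borel_measurable borel"
  shows "density lborel f \<in> P2 \<longleftrightarrow>
    (\<integral>\<^sup>+ x. f x \<partial>lborel) = 1 \<and> (\<integral>\<^sup>+ x. f x * ennreal ((norm x)\<^sup>2) \<partial>lborel) < \<infinity>"
proof -
  have "prob_space (density lborel f) \<longleftrightarrow> (\<integral>\<^sup>+ x. f x \<partial>lborel) = 1"
    using prob_space.emeasure_space_1[of "density lborel f"] prob_spaceI[of "density lborel f"]
    by (auto simp: emeasure_density)
  then show ?thesis
    by (simp add: P2_def second_moment_def nn_integral_density)
qed

text \<open>From a plan \<open>\<gamma>\<close> of \<open>g\<close>, keep the part \<open>min f g\<close> of the first marginal and
  redistribute the remaining mass \<open>\<delta>\<close> independently according to \<open>(f - g)\<^sup>+ / \<delta>\<close>.\<close>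

lemma transport_cost_density_le:
  fixes f g :: "'a::euclidean_space \<Rightarrow> real"
  assumes [measurable]: "f \<in> borel_measurable borel" "g \<in> borel_measurable borel"
    and nonneg: "\<And>x. 0 \<le> f x" "\<And>x. 0 \<le> g x"
    and P2: "density lborel f \<in> P2" "density lborel g \<in> P2" "\<nu> \<in> P2"
  shows "transport_cost (density lborel f) \<nu> \<le> transport_cost (density lborel g) \<nu> +
    (2 * (\<integral>\<^sup>+ x. ennreal (f x - g x) * ennreal ((norm x)\<^sup>2) \<partial>lborel) +
     2 * ((\<integral>\<^sup>+ y. ennreal ((norm y)\<^sup>2) * indicator {y. R < norm y} y \<partial>\<nu>) +
       ennreal (R\<^sup>2) * (\<integral>\<^sup>+ x. ennreal (f x - g x) \<partial>lborel)))"
    (is "_ \<le> _ + (2 * ?X + 2 * (?Y + _ * _))")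
proof -
  define \<delta> where "\<delta> = (\<integral>\<^sup>+ x. ennreal (f x - g x) \<partial>lborel)"
  \<comment> \<open>The fraction of the mass of \<open>g\<close> at \<open>x\<close> that may stay.
    Where \<open>g x = 0\<close>, division by zero gives \<open>r x = 0\<close>, which is harmless
    because \<open>r\<close> only enters multiplied by \<open>g\<close>.\<close>
  define r where "r x = min 1 (f x / g x)" for x
  have [measurable]: "r \<in> borel_measurable borel"
    unfolding r_def by measurable
  have r: "0 \<le> r x" "r x \<le> 1" for x
    using nonneg by (auto simp: r_def)
  have gr: "g x * r x = min (f x) (g x)" "g x * (1 - r x) = max 0 (g x - f x)" for x
    using nonneg[of x] by (auto simp: r_def min_def max_def field_simps)
  have f1: "(\<integral>\<^sup>+ x. ennreal (f x) \<partial>lborel) = 1" "(\<integral>\<^sup>+ x. ennreal (g x) \<partial>lborel) = 1"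
    using P2 by (simp_all add: density_P2_iff)
  have "\<delta> \<le> (\<integral>\<^sup>+ x. ennreal (f x) \<partial>lborel)"
    unfolding \<delta>_def using nonneg by (intro nn_integral_mono ennreal_leI) simp
  then have "\<delta> \<noteq> top"
    using f1 by (auto simp: top_unique)
  \<comment> \<open>Both densities have mass 1, so the excess of \<open>g\<close> over
    \<open>f\<close> equals the excess of \<open>f\<close> over \<open>g\<close>: the mass taken
    away is the mass to be put back.\<close>
  have \<delta>': "(\<integral>\<^sup>+ x. ennreal (g x - f x) \<partial>lborel) = \<delta>"
  proof -
    let ?m = "\<integral>\<^sup>+ x. ennreal (min (f x) (g x)) \<partial>lborel"
    have min: "ennreal (min a b) + ennreal (a - b) = ennreal a" if "0 \<le> a" "0 \<le> b" for a b :: real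
      using that by (cases "a \<le> b") (simp_all add: ennreal_neg flip: ennreal_plus)
    have "?m + \<delta> = (\<integral>\<^sup>+ x. ennreal (f x) \<partial>lborel)"
      unfolding \<delta>_def using nonneg by (subst nn_integral_add[symmetric]) (simp_all add: min)
    moreover have "?m + (\<integral>\<^sup>+ x. ennreal (g x - f x) \<partial>lborel) = (\<integral>\<^sup>+ x. ennreal (g x) \<partial>lborel)"
      using nonneg by (subst nn_integral_add[symmetric]) (simp_all add: min min.commute[of "f _"])
    moreover from this have "?m \<noteq> top"
      using f1 by auto
    ultimately show ?thesis
      using f1 by (metis ennreal_add_left_cancel infinity_ennreal_def)
  qed
  define c where "c = inverse \<delta>"
  \<comment> \<open>If \<open>\<delta> = 0\<close>, then \<open>c = top\<close> and
    \<open>c * \<delta>\<close> is 0 rather than 1. In the marginal computations \<open>q\<close> is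
    at most \<open>\<delta>\<close>, so it vanishes too and no separate case is required.\<close>
  have cancel: "q * (c * \<delta>) = q" if "\<delta> = 0 \<Longrightarrow> q = 0" for q
    using that \<open>\<delta> \<noteq> top\<close>
    by (cases "\<delta> = 0") (simp_all add: c_def mult.commute[of "inverse \<delta>"] divide_ennreal_def[symmetric] less_top[symmetric])
  have c\<delta>: "c * \<delta> \<le> 1"
    using cancel[of 1] by (cases "\<delta> = 0") auto
  define N where "N = density lborel (\<lambda>x. ennreal (f x - g x) * c)"
  have sets_N [measurable_cong]: "sets N = sets borel"
    by (simp add: N_def)
  have int_N: "(\<integral>\<^sup>+ x. h x \<partial>N) = c * (\<integral>\<^sup>+ x. ennreal (f x - g x) * h x \<partial>lborel)"
    if [measurable]: "h \<in> borel_measurable borel" for h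
    unfolding N_def by (simp add: nn_integral_density nn_integral_cmult[symmetric] ac_simps)
  have mass_N: "emeasure N (space N) = c * \<delta>"
    using int_N[of "\<lambda>_. 1"] by (simp add: \<delta>_def)
  interpret N: finite_measure N
    using c\<delta> mass_N by (intro finite_measureI) (auto simp: top_unique)
  have "transport_cost (density lborel f) \<nu> \<le> ennreal 1 * transport_cost (density lborel g) \<nu> +
    (2 * ?X + 2 * (?Y + ennreal (R\<^sup>2) * \<delta>))"
  proof (intro le_affine_transport_cost[OF transport_cost_finite] P2)
    fix \<gamma> assume \<gamma>: "\<gamma> \<in> transport_plans (density lborel g) \<nu>"
    note [measurable_cong] = transport_planD(2)[OF \<gamma>]
    define L where "L = density \<gamma> (\<lambda>z. ennreal (1 - r (fst z)))"
    have sets_L [measurable_cong]: "sets L = sets (borel \<Otimes>\<^sub>M borel)"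
      by (simp add: L_def transport_planD(2)[OF \<gamma>])
    \<comment> \<open>The second summand keeps the targets of the removed mass \<open>L\<close> and
      draws new starting points from \<open>N\<close>, independently of them. Both marginals
      therefore come out right.\<close>
    define \<gamma>' where "\<gamma>' = plus_measure (density \<gamma> (\<lambda>z. ennreal (r (fst z))))
      (distr (L \<Otimes>\<^sub>M N) (borel \<Otimes>\<^sub>M borel) (\<lambda>p. (snd p, snd (fst p))))"
    have int: "(\<integral>\<^sup>+ z. h z \<partial>\<gamma>') = (\<integral>\<^sup>+ z. ennreal (r (fst z)) * h z \<partial>\<gamma>) +
        (\<integral>\<^sup>+ z. ennreal (1 - r (fst z)) * (\<integral>\<^sup>+ x. h (x, snd z) \<partial>N) \<partial>\<gamma>)"
      if [measurable]: "h \<in> borel_measurable (borel \<Otimes>\<^sub>M borel)" for h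
    proof -
      have "(\<integral>\<^sup>+ z. h z \<partial>\<gamma>') = (\<integral>\<^sup>+ z. h z \<partial>density \<gamma> (\<lambda>z. ennreal (r (fst z)))) +
          (\<integral>\<^sup>+ z. h z \<partial>distr (L \<Otimes>\<^sub>M N) (borel \<Otimes>\<^sub>M borel) (\<lambda>p. (snd p, snd (fst p))))"
        unfolding \<gamma>'_def by (rule nn_integral_plus_measure) (simp_all add: transport_planD(2)[OF \<gamma>])
      also have "(\<integral>\<^sup>+ z. h z \<partial>density \<gamma> (\<lambda>z. ennreal (r (fst z)))) =
          (\<integral>\<^sup>+ z. ennreal (r (fst z)) * h z \<partial>\<gamma>)"
        by (rule nn_integral_density) auto
      also have "(\<integral>\<^sup>+ z. h z \<partial>distr (L \<Otimes>\<^sub>M N) (borel \<Otimes>\<^sub>M borel) (\<lambda>p. (snd p, snd (fst p)))) =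
          (\<integral>\<^sup>+ p. h (snd p, snd (fst p)) \<partial>(L \<Otimes>\<^sub>M N))"
        by (rule nn_integral_distr) auto
      also have "\<dots> = (\<integral>\<^sup>+ z. (\<integral>\<^sup>+ x. h (x, snd z) \<partial>N) \<partial>L)"
        by (subst N.nn_integral_fst[symmetric]) auto
      also have "\<dots> = (\<integral>\<^sup>+ z. ennreal (1 - r (fst z)) * (\<integral>\<^sup>+ x. h (x, snd z) \<partial>N) \<partial>\<gamma>)"
        unfolding L_def by (rule nn_integral_density) auto
      finally show ?thesis .
    qed
    have lost: "(\<integral>\<^sup>+ z. ennreal (1 - r (fst z)) \<partial>\<gamma>) = \<delta>"
    proof -
      have "(\<integral>\<^sup>+ z. ennreal (1 - r (fst z)) \<partial>\<gamma>) = (\<integral>\<^sup>+ x. ennreal (1 - r x) \<partial>density lborel g)"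
        by (rule nn_integral_transport_plan[OF \<gamma>]) auto
      also have "\<dots> = (\<integral>\<^sup>+ x. ennreal (g x) * ennreal (1 - r x) \<partial>lborel)"
        by (rule nn_integral_density) auto
      also have "\<dots> = (\<integral>\<^sup>+ x. ennreal (g x - f x) \<partial>lborel)"
        using nonneg r by (intro nn_integral_cong) (simp add: ennreal_mult[symmetric] gr max_def ennreal_neg)
      finally show ?thesis
        by (simp add: \<delta>')
    qed
    have split: "(\<integral>\<^sup>+ z. ennreal (r (fst z)) * h z \<partial>\<gamma>) + (\<integral>\<^sup>+ z. ennreal (1 - r (fst z)) * h z \<partial>\<gamma>) =
        (\<integral>\<^sup>+ z. h z \<partial>\<gamma>)" if [measurable]: "h \<in> borel_measurable (borel \<Otimes>\<^sub>M borel)" for h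
      using r by (subst nn_integral_add[symmetric])
        (auto intro!: nn_integral_cong simp: distrib_right[symmetric] ennreal_plus[symmetric] simp del: ennreal_plus)
    have "\<gamma>' \<in> transport_plans (density lborel f) \<nu>"
    proof (rule transport_planI)
      show "sets \<gamma>' = sets (borel \<Otimes>\<^sub>M borel)"
        by (simp add: \<gamma>'_def transport_planD(2)[OF \<gamma>])
      fix A :: "'a set" assume [measurable]: "A \<in> sets borel"
      then have A: "A \<in> sets \<nu>"
        using P2 by (auto dest: P2D)
      let ?q = "\<integral>\<^sup>+ x. ennreal (f x - g x) * indicator A x \<partial>lborel"
      have q: "?q * (c * \<delta>) = ?q"
      proof (rule cancel)
        assume "\<delta> = 0"
        moreover have "?q \<le> \<delta>"
          unfolding \<delta>_def by (intro nn_integral_mono) (auto simp: indicator_def)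
        ultimately show "?q = 0"
          by simp
      qed
      have "(\<integral>\<^sup>+ z. indicator A (fst z) \<partial>\<gamma>') =
          (\<integral>\<^sup>+ z. ennreal (r (fst z)) * indicator A (fst z) \<partial>\<gamma>) +
          (\<integral>\<^sup>+ z. ennreal (1 - r (fst z)) * (c * ?q) \<partial>\<gamma>)"
        by (simp add: int int_N del: nn_integral_indicator)
      also have "(\<integral>\<^sup>+ z. ennreal (1 - r (fst z)) * (c * ?q) \<partial>\<gamma>) = ?q"
        using q by (subst nn_integral_multc) (simp_all add: lost, simp add: ac_simps)
      also have "(\<integral>\<^sup>+ z. ennreal (r (fst z)) * indicator A (fst z) \<partial>\<gamma>) =
          (\<integral>\<^sup>+ x. ennreal (r x) * indicator A x \<partial>density lborel g)"
        by (rule nn_integral_transport_plan[OF \<gamma>]) auto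
      also have "\<dots> = (\<integral>\<^sup>+ x. ennreal (g x) * (ennreal (r x) * indicator A x) \<partial>lborel)"
        by (rule nn_integral_density) auto
      also have "\<dots> + ?q = (\<integral>\<^sup>+ x. ennreal (g x) * (ennreal (r x) * indicator A x) + ennreal (f x - g x) * indicator A x \<partial>lborel)"
        by (rule nn_integral_add[symmetric]) auto
      also have "\<dots> = (\<integral>\<^sup>+ x. ennreal (f x) * indicator A x \<partial>lborel)"
      proof (rule nn_integral_cong)
        fix x
        have "ennreal (g x) * ennreal (r x) + ennreal (f x - g x) = ennreal (f x)"
          using nonneg[of x] r[of x]
          by (cases "f x \<le> g x") (simp_all add: ennreal_mult[symmetric] gr ennreal_plus[symmetric] ennreal_neg del: ennreal_plus)
        then show "ennreal (g x) * (ennreal (r x) * indicator A x) + ennreal (f x - g x) * indicator A x =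
            ennreal (f x) * indicator A x"
          by (simp add: mult.assoc[symmetric] distrib_right[symmetric])
      qed
      also have "\<dots> = emeasure (density lborel f) A"
        by (simp add: emeasure_density)
      finally show "(\<integral>\<^sup>+ z. indicator A (fst z) \<partial>\<gamma>') = emeasure (density lborel f) A" .
      let ?p = "\<integral>\<^sup>+ z. ennreal (1 - r (fst z)) * indicator A (snd z) \<partial>\<gamma>"
      have p: "?p * (c * \<delta>) = ?p"
      proof (rule cancel)
        assume "\<delta> = 0"
        moreover have "?p \<le> \<delta>"
          unfolding lost[symmetric] by (intro nn_integral_mono) (auto simp: indicator_def)
        ultimately show "?p = 0"
          by simp
      qed
      have "(\<integral>\<^sup>+ z. indicator A (snd z) \<partial>\<gamma>') =
          (\<integral>\<^sup>+ z. ennreal (r (fst z)) * indicator A (snd z) \<partial>\<gamma>) +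
          (\<integral>\<^sup>+ z. ennreal (1 - r (fst z)) * (indicator A (snd z) * (c * \<delta>)) \<partial>\<gamma>)"
        by (simp add: int mass_N)
      also have "(\<integral>\<^sup>+ z. ennreal (1 - r (fst z)) * (indicator A (snd z) * (c * \<delta>)) \<partial>\<gamma>) = ?p"
        using p by (simp add: nn_integral_multc mult.assoc[symmetric])
      also have "(\<integral>\<^sup>+ z. ennreal (r (fst z)) * indicator A (snd z) \<partial>\<gamma>) + ?p = (\<integral>\<^sup>+ z. indicator A (snd z) \<partial>\<gamma>)"
        by (rule split) auto
      also have "\<dots> = (\<integral>\<^sup>+ y. indicator A y \<partial>\<nu>)"
        by (rule nn_integral_transport_plan[OF \<gamma>]) auto
      also have "\<dots> = emeasure \<nu> A"
        using A by simp
      finally show "(\<integral>\<^sup>+ z. indicator A (snd z) \<partial>\<gamma>') = emeasure \<nu> A" .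
    qed (use P2 in \<open>auto dest: P2D\<close>)
    then have "transport_cost (density lborel f) \<nu> \<le> (\<integral>\<^sup>+ z. ennreal ((dist (fst z) (snd z))\<^sup>2) \<partial>\<gamma>')"
      by (rule transport_cost_le)
    also have "\<dots> = (\<integral>\<^sup>+ z. ennreal (r (fst z)) * ennreal ((dist (fst z) (snd z))\<^sup>2) \<partial>\<gamma>) +
        (\<integral>\<^sup>+ z. ennreal (1 - r (fst z)) * (\<integral>\<^sup>+ x. ennreal ((dist x (snd z))\<^sup>2) \<partial>N) \<partial>\<gamma>)"
      by (subst int) auto
    also have "\<dots> \<le> (\<integral>\<^sup>+ z. ennreal ((dist (fst z) (snd z))\<^sup>2) \<partial>\<gamma>) +
        (\<integral>\<^sup>+ z. ennreal (1 - r (fst z)) * (2 * c * ?X) +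
          2 * (ennreal ((norm (snd z))\<^sup>2) * indicator {y. R < norm y} (snd z) + ennreal (R\<^sup>2) * ennreal (1 - r (fst z))) \<partial>\<gamma>)"
    proof (intro add_mono nn_integral_mono)
      fix z :: "'a \<times> 'a"
      have "ennreal (r (fst z)) * ennreal ((dist (fst z) (snd z))\<^sup>2) \<le> 1 * ennreal ((dist (fst z) (snd z))\<^sup>2)"
        using r by (intro mult_right_mono) auto
      then show "ennreal (r (fst z)) * ennreal ((dist (fst z) (snd z))\<^sup>2) \<le> ennreal ((dist (fst z) (snd z))\<^sup>2)"
        by simp
      have "(\<integral>\<^sup>+ x. ennreal ((dist x (snd z))\<^sup>2) \<partial>N) \<le>
          (\<integral>\<^sup>+ x. 2 * ennreal ((norm x)\<^sup>2) + 2 * ennreal ((norm (snd z))\<^sup>2) \<partial>N)"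
        using dist_sq_le
        by (intro nn_integral_mono) (simp add: ennreal_mult''[symmetric] ennreal_plus[symmetric] del: ennreal_plus flip: ennreal_numeral)
      also have "\<dots> = 2 * c * ?X + 2 * ennreal ((norm (snd z))\<^sup>2) * (c * \<delta>)"
        by (simp add: nn_integral_add nn_integral_cmult int_N mass_N mult.assoc)
      also have "\<dots> \<le> 2 * c * ?X + 2 * ennreal ((norm (snd z))\<^sup>2) * 1"
        using c\<delta> by (intro add_left_mono mult_left_mono) auto
      finally have "ennreal (1 - r (fst z)) * (\<integral>\<^sup>+ x. ennreal ((dist x (snd z))\<^sup>2) \<partial>N) \<le>
          ennreal (1 - r (fst z)) * (2 * c * ?X + 2 * ennreal ((norm (snd z))\<^sup>2))"
        by (intro mult_left_mono) auto
      also have "\<dots> = ennreal (1 - r (fst z)) * (2 * c * ?X) + 2 * (ennreal (1 - r (fst z)) * ennreal ((norm (snd z))\<^sup>2))"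
        by (simp add: distrib_left ac_simps)
      \<comment> \<open>Targets of the moved mass may lie far out, and their second moment is not
        controlled by \<open>\<delta>\<close> alone. Beyond \<open>R\<close> the moved fraction is
        bounded by 1, leaving a tail of \<open>\<nu>\<close>; within \<open>R\<close> the square is
        bounded by \<open>R\<^sup>2\<close>, leaving a multiple of the moved mass.\<close>
      also have "ennreal (1 - r (fst z)) * ennreal ((norm (snd z))\<^sup>2) \<le>
          ennreal ((norm (snd z))\<^sup>2) * indicator {y. R < norm y} (snd z) + ennreal (R\<^sup>2) * ennreal (1 - r (fst z))"
      proof (cases "R < norm (snd z)")
        case True
        have "ennreal (1 - r (fst z)) * ennreal ((norm (snd z))\<^sup>2) \<le> 1 * ennreal ((norm (snd z))\<^sup>2)"
          using r by (intro mult_right_mono) auto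
        also have "\<dots> \<le> ennreal ((norm (snd z))\<^sup>2) + ennreal (R\<^sup>2) * ennreal (1 - r (fst z))"
          by simp
        finally show ?thesis
          using True by simp
      next
        case False
        then have "(norm (snd z))\<^sup>2 \<le> R\<^sup>2"
          by (intro power_mono) auto
        then have "ennreal ((norm (snd z))\<^sup>2) \<le> ennreal (R\<^sup>2)"
          by (rule ennreal_leI)
        then show ?thesis
          using False by (simp add: mult.commute mult_left_mono)
      qed
      finally show "ennreal (1 - r (fst z)) * (\<integral>\<^sup>+ x. ennreal ((dist x (snd z))\<^sup>2) \<partial>N) \<le>
          ennreal (1 - r (fst z)) * (2 * c * ?X) +
          2 * (ennreal ((norm (snd z))\<^sup>2) * indicator {y. R < norm y} (snd z) + ennreal (R\<^sup>2) * ennreal (1 - r (fst z)))"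
        by (simp add: add_left_mono mult_left_mono)
    qed
    also have "(\<integral>\<^sup>+ z. ennreal (1 - r (fst z)) * (2 * c * ?X) +
          2 * (ennreal ((norm (snd z))\<^sup>2) * indicator {y. R < norm y} (snd z) + ennreal (R\<^sup>2) * ennreal (1 - r (fst z))) \<partial>\<gamma>) =
        \<delta> * (2 * c * ?X) + 2 * ((\<integral>\<^sup>+ z. ennreal ((norm (snd z))\<^sup>2) * indicator {y. R < norm y} (snd z) \<partial>\<gamma>) + ennreal (R\<^sup>2) * \<delta>)"
      by (simp add: nn_integral_add nn_integral_cmult nn_integral_multc lost)
    also have "(\<integral>\<^sup>+ z. ennreal ((norm (snd z))\<^sup>2) * indicator {y. R < norm y} (snd z) \<partial>\<gamma>) = ?Y"
      by (rule nn_integral_transport_plan[OF \<gamma>]) auto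
    also have "\<delta> * (2 * c * ?X) = (c * \<delta>) * (2 * ?X)"
      by (simp add: ac_simps)
    also have "\<dots> \<le> 1 * (2 * ?X)"
      using c\<delta> by (intro mult_right_mono) auto
    finally show "transport_cost (density lborel f) \<nu> \<le>
        ennreal 1 * (\<integral>\<^sup>+ z. ennreal ((dist (fst z) (snd z))\<^sup>2) \<partial>\<gamma>) + (2 * ?X + 2 * (?Y + ennreal (R\<^sup>2) * \<delta>))"
      by (simp add: add_left_mono add_right_mono)
  qed simp
  then show ?thesis
    by (simp add: \<delta>_def)
qed

text \<open>\<open>transport_cost_density_le\<close> is applied with the limit \<open>g\<close> in
  the role of \<open>f\<close>. Its error involves only the positive part of \<open>g - f n\<close>,
  which is dominated by \<open>g\<close>, so dominated convergence applies even if the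
  \<open>f n\<close> carry second moment off to infinity.\<close>

lemma transport_cost_le_liminf:
  fixes f :: "nat \<Rightarrow> 'a::euclidean_space \<Rightarrow> real"
  assumes [measurable]: "g \<in> borel_measurable borel" "\<And>n. f n \<in> borel_measurable borel"
    and nonneg: "\<And>x. 0 \<le> g x" "\<And>n x. 0 \<le> f n x"
    and P2: "density lborel g \<in> P2" "\<And>n. density lborel (f n) \<in> P2" "\<nu> \<in> P2"
    and lim: "AE x in lborel. (\<lambda>n. f n x) \<longlonglongrightarrow> g x"
  shows "transport_cost (density lborel g) \<nu> \<le> liminf (\<lambda>n. transport_cost (density lborel (f n)) \<nu>)"
proof (rule ennreal_le_epsilon)
  fix e :: real assume "0 < e"
  have conv: "(\<lambda>n. \<integral>\<^sup>+ x. ennreal (g x - f n x) * h x \<partial>lborel) \<longlonglongrightarrow> 0"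
    if [measurable]: "h \<in> borel_measurable borel" and fin: "(\<integral>\<^sup>+ x. ennreal (g x) * h x \<partial>lborel) < \<infinity>"
      and h: "\<And>x. h x < top" for h
  proof -
    have "(\<lambda>n. \<integral>\<^sup>+ x. ennreal (g x - f n x) * h x \<partial>lborel) \<longlonglongrightarrow> (\<integral>\<^sup>+ (x :: 'a). 0 \<partial>lborel)"
    proof (rule nn_integral_dominated_convergence)
      show "AE x in lborel. ennreal (g x - f n x) * h x \<le> ennreal (g x) * h x" for n
        using nonneg by (intro AE_I2 mult_right_mono ennreal_leI) auto
      show "AE x in lborel. (\<lambda>n. ennreal (g x - f n x) * h x) \<longlonglongrightarrow> 0"
        using lim
      proof eventually_elim
        case (elim x)
        have "(\<lambda>n. ennreal (g x - f n x) * h x) \<longlonglongrightarrow> ennreal (g x - g x) * h x"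
          using h[of x] by (intro tendsto_mult_ennreal tendsto_ennrealI tendsto_intros elim) auto
        then show ?case
          by simp
      qed
    qed (use fin in auto)
    then show ?thesis
      by simp
  qed
  let ?Y = "\<lambda>R. \<integral>\<^sup>+ y. ennreal ((norm y)\<^sup>2) * indicator {y. R < norm y} y \<partial>\<nu>"
  note [measurable_cong] = P2D(2)[OF P2(3)]
  have "(\<lambda>k. ?Y (real k)) \<longlonglongrightarrow> (\<integral>\<^sup>+ y. 0 \<partial>\<nu>)"
  proof (rule nn_integral_dominated_convergence)
    show "AE y in \<nu>. ennreal ((norm y)\<^sup>2) * indicator {y. real k < norm y} y \<le> ennreal ((norm y)\<^sup>2)" for k
      by (auto simp: indicator_def)
    show "(\<integral>\<^sup>+ y. ennreal ((norm y)\<^sup>2) \<partial>\<nu>) < \<infinity>"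
      using P2D(3)[OF P2(3)] by (simp add: second_moment_def)
    show "AE y in \<nu>. (\<lambda>k. ennreal ((norm y)\<^sup>2) * indicator {y. real k < norm y} y) \<longlonglongrightarrow> 0"
    proof (intro AE_I2 tendsto_eventually)
      fix y :: 'a
      have "eventually (\<lambda>k. norm y \<le> real k) sequentially"
        by (rule eventually_sequentiallyI[of "nat \<lceil>norm y\<rceil>"]) linarith
      then show "eventually (\<lambda>k. ennreal ((norm y)\<^sup>2) * indicator {y. real k < norm y} y = 0) sequentially"
        by eventually_elim simp
    qed
  qed auto
  then have "eventually (\<lambda>k. ?Y (real k) < ennreal (e / 6)) sequentially"
    using \<open>0 < e\<close> by (intro order_tendstoD) auto
  \<comment> \<open>\<open>R\<close> depends on \<open>\<nu>\<close> only and is fixed before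
    \<open>n\<close>. The total error is then \<open>2 * (e / 6) + e / 2\<close>, which is at most
    \<open>e\<close>.\<close>
  then obtain R where R: "?Y R < ennreal (e / 6)"
    by (auto simp: eventually_sequentially)
  have m2: "(\<integral>\<^sup>+ x. ennreal (g x) * ennreal ((norm x)\<^sup>2) \<partial>lborel) < \<infinity>" "(\<integral>\<^sup>+ x. ennreal (g x) \<partial>lborel) = 1"
    using P2(1) by (simp_all add: density_P2_iff)
  have "(\<lambda>n. 2 * (\<integral>\<^sup>+ x. ennreal (g x - f n x) * ennreal ((norm x)\<^sup>2) \<partial>lborel) +
      2 * (ennreal (R\<^sup>2) * (\<integral>\<^sup>+ x. ennreal (g x - f n x) * 1 \<partial>lborel))) \<longlonglongrightarrow> 2 * 0 + 2 * (ennreal (R\<^sup>2) * 0)"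
    by (intro tendsto_add ennreal_tendsto_cmult conv) (use m2 in auto)
  then have "eventually (\<lambda>n. 2 * (\<integral>\<^sup>+ x. ennreal (g x - f n x) * ennreal ((norm x)\<^sup>2) \<partial>lborel) +
      2 * (ennreal (R\<^sup>2) * (\<integral>\<^sup>+ x. ennreal (g x - f n x) * 1 \<partial>lborel)) < ennreal (e / 2)) sequentially"
    using \<open>0 < e\<close> by (intro order_tendstoD) auto
  then have "eventually (\<lambda>n. transport_cost (density lborel g) \<nu> \<le> transport_cost (density lborel (f n)) \<nu> + ennreal e) sequentially"
  proof eventually_elim
    case (elim n)
    let ?a = "2 * (\<integral>\<^sup>+ x. ennreal (g x - f n x) * ennreal ((norm x)\<^sup>2) \<partial>lborel)"
    let ?b = "ennreal (R\<^sup>2) * (\<integral>\<^sup>+ x. ennreal (g x - f n x) \<partial>lborel)"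
    have "transport_cost (density lborel g) \<nu> \<le> transport_cost (density lborel (f n)) \<nu> + (?a + 2 * (?Y R + ?b))"
      by (rule transport_cost_density_le) (use nonneg P2 in auto)
    also have "?a + 2 * (?Y R + ?b) = (?a + 2 * ?b) + 2 * ?Y R"
      by (simp add: distrib_left ac_simps)
    also have "\<dots> \<le> ennreal (e / 2) + 2 * ennreal (e / 6)"
      using elim R by (intro add_mono mult_left_mono) auto
    also have "\<dots> = ennreal (e / 2 + 2 * (e / 6))"
      using \<open>0 < e\<close> by (subst ennreal_plus) (auto simp: ennreal_mult'' simp del: times_divide_eq_right)
    also have "\<dots> \<le> ennreal e"
      using \<open>0 < e\<close> by (intro ennreal_leI) simp
    finally show ?case
      by (simp add: add_left_mono)
  qed
  then have "transport_cost (density lborel g) \<nu> \<le> liminf (\<lambda>n. transport_cost (density lborel (f n)) \<nu> + ennreal e)"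
    by (rule Liminf_bounded)
  also have "\<dots> = liminf (\<lambda>n. transport_cost (density lborel (f n)) \<nu>) + ennreal e"
    by (rule Liminf_add_const) simp
  finally show "transport_cost (density lborel g) \<nu> \<le> liminf (\<lambda>n. transport_cost (density lborel (f n)) \<nu>) + ennreal e" .
qed

text \<open>Superadditivity of the lower limit, obtained as Fatou's lemma for counting measure on
  two points.\<close>

lemma liminf_add_le_ennreal: "liminf x + liminf y \<le> liminf (\<lambda>n. x n + y n :: ennreal)"
proof -
  have "(\<integral>\<^sup>+ b. liminf (\<lambda>n. if b then x n else y n) \<partial>count_space (UNIV :: bool set)) \<le>
      liminf (\<lambda>n. \<integral>\<^sup>+ b. (if b then x n else y n) \<partial>count_space (UNIV :: bool set))"
    by (rule nn_integral_liminf) simp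
  then show ?thesis
    by (simp add: nn_integral_count_space_finite UNIV_bool add.commute)
qed

subsection \<open>Convexity of the entropy and Gaussian bounds\<close>

text \<open>The right-hand side is the excess of \<open>t * ln t\<close> over its tangent at
  \<open>m\<close>; the bound is \<open>ln u \<le> u - 1\<close> for
  \<open>u = sqrt m / sqrt t\<close>. Taking \<open>m\<close> as a midpoint gives the convexity gap,
  taking it as a Gaussian gives the lower bound on the entropy.\<close>

lemma entropy_ge_tangent:
  fixes t m :: real
  assumes "0 \<le> t" "0 < m"
  shows "(sqrt t - sqrt m)\<^sup>2 \<le> t * ln t - t * ln m - t + m"
proof (cases "t = 0")
  case False
  then have "0 < t"
    using assms by simp
  have "ln (sqrt m / sqrt t) \<le> sqrt m / sqrt t - 1"
    using \<open>0 < t\<close> assms by (intro ln_le_minus_one) simp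
  then have "(ln m - ln t) / 2 \<le> sqrt m / sqrt t - 1"
    using \<open>0 < t\<close> assms by (simp add: ln_div ln_sqrt diff_divide_distrib)
  then have "t * ((ln m - ln t) / 2) \<le> t * (sqrt m / sqrt t - 1)"
    using assms by (intro mult_left_mono)
  also have "t * (sqrt m / sqrt t - 1) = t / sqrt t * sqrt m - t"
    by (simp add: right_diff_distrib)
  also have "t / sqrt t = sqrt t"
    using assms by (simp add: real_div_sqrt)
  finally have "t * ln m - t * ln t \<le> 2 * (sqrt t * sqrt m) - 2 * t"
    by (simp add: right_diff_distrib diff_divide_distrib)
  moreover have "(sqrt t - sqrt m)\<^sup>2 = t + m - 2 * (sqrt t * sqrt m)"
    using assms by (simp add: power2_diff)
  ultimately show ?thesis
    by linarith
qed (use assms in simp)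

text \<open>Add the tangent inequalities of \<open>a\<close> and \<open>b\<close> at their mean
  \<open>m\<close>: the linear terms cancel. The two squares that remain sum to at least half of
  \<open>(sqrt a - sqrt b)\<^sup>2\<close>, and halving gives the constant 1/4.\<close>

lemma entropy_midpoint_gap:
  fixes a b :: real
  assumes "0 \<le> a" "0 \<le> b"
  shows "(a + b) / 2 * ln ((a + b) / 2) + (sqrt a - sqrt b)\<^sup>2 / 4 \<le> (a * ln a + b * ln b) / 2"
proof (cases "a + b = 0")
  case False
  define m where "m = (a + b) / 2"
  have "0 < m"
    using False assms by (simp add: m_def)
  have "(sqrt a - sqrt b)\<^sup>2 \<le> 2 * (sqrt a - sqrt m)\<^sup>2 + 2 * (sqrt b - sqrt m)\<^sup>2"
  proof -
    have "(p - q)\<^sup>2 \<le> 2 * (p - r)\<^sup>2 + 2 * (q - r)\<^sup>2" for p q r :: real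
    proof -
      have "2 * (p - r)\<^sup>2 + 2 * (q - r)\<^sup>2 - (p - q)\<^sup>2 = (p + q - 2 * r)\<^sup>2"
        by (simp add: power2_eq_square algebra_simps)
      then show ?thesis
        by (metis diff_ge_0_iff_ge zero_le_power2)
    qed
    then show ?thesis .
  qed
  moreover have "a * ln m + b * ln m = 2 * (m * ln m)"
    by (simp add: m_def field_simps)
  moreover have "a + b = 2 * m"
    by (simp add: m_def)
  ultimately show ?thesis
    using entropy_ge_tangent[OF assms(1) \<open>0 < m\<close>] entropy_ge_tangent[OF assms(2) \<open>0 < m\<close>]
    unfolding m_def[symmetric]
    by (simp add: field_simps)
next
  case True
  then have "a = 0" "b = 0"
    using assms by auto
  then show ?thesis
    by simp
qed

lemma integrable_gaussian:
  assumes "0 < \<epsilon>"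
  shows "integrable lborel (\<lambda>x :: 'a::euclidean_space. exp (- \<epsilon> * (norm x)\<^sup>2))"
proof (rule integrableI_nonneg)
  have one: "(\<integral>\<^sup>+ t. ennreal (exp (- \<epsilon> * t\<^sup>2)) \<partial>lborel) < \<infinity>"
  proof -
    \<comment> \<open>The standard deviation for which the normal density is proportional to
      \<open>exp (- \<epsilon> * t\<^sup>2)\<close>.\<close>
    define \<sigma> where "\<sigma> = 1 / sqrt (2 * \<epsilon>)"
    have \<sigma>: "0 < \<sigma>" "2 * \<sigma>\<^sup>2 = 1 / \<epsilon>"
      using assms by (simp_all add: \<sigma>_def power_divide)
    have "integrable lborel (\<lambda>t. sqrt (2 * pi * \<sigma>\<^sup>2) * normal_density 0 \<sigma> t)"
      using integrable_normal_density[OF \<sigma>(1), of 0] by simp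
    moreover have "sqrt (2 * pi * \<sigma>\<^sup>2) * normal_density 0 \<sigma> t = exp (- \<epsilon> * t\<^sup>2)" for t
      using \<sigma> by (simp add: normal_density_def)
    ultimately have "integrable lborel (\<lambda>t. exp (- \<epsilon> * t\<^sup>2))"
      by simp
    then show ?thesis
      by (simp add: integrable_iff_bounded)
  qed
  have "(norm x)\<^sup>2 = (\<Sum>b\<in>Basis. (x \<bullet> b)\<^sup>2)" for x :: 'a
    unfolding power2_norm_eq_inner by (subst euclidean_inner) (simp add: power2_eq_square)
  then have "exp (- \<epsilon> * (norm x)\<^sup>2) = (\<Prod>b\<in>Basis. exp (- \<epsilon> * (x \<bullet> b)\<^sup>2))" for x :: 'a
    by (simp add: exp_sum[symmetric] sum_distrib_left sum_negf)
  then have "(\<integral>\<^sup>+ (x :: 'a). ennreal (exp (- \<epsilon> * (norm x)\<^sup>2)) \<partial>lborel) =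
      (\<integral>\<^sup>+ (x :: 'a). (\<Prod>b\<in>Basis. ennreal (exp (- \<epsilon> * (x \<bullet> b)\<^sup>2))) \<partial>lborel)"
    by (simp add: prod_ennreal)
  also have "\<dots> = (\<Prod>b\<in>(Basis :: 'a set). (\<integral>\<^sup>+ t. ennreal (exp (- \<epsilon> * t\<^sup>2)) \<partial>lborel))"
    by (rule nn_integral_lborel_prod) auto
  also have "\<dots> < \<infinity>"
    using one by (simp add: power_less_top_ennreal)
  finally show "(\<integral>\<^sup>+ (x :: 'a). ennreal (exp (- \<epsilon> * (norm x)\<^sup>2)) \<partial>lborel) < \<infinity>" .
qed auto

text \<open>The tangent inequality at \<open>m = exp (- \<epsilon> * (norm x)\<^sup>2)\<close>, with
  the square dropped. The summands \<open>- t\<close> and the Gaussian integrate to constants, so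
  the only variable cost is \<open>\<epsilon>\<close> times the second moment.\<close>

lemma entropy_gaussian_nonneg:
  fixes t :: real
  assumes "0 \<le> t"
  shows "0 \<le> t * ln t + \<epsilon> * (t * (norm x)\<^sup>2) - t + exp (- \<epsilon> * (norm x)\<^sup>2)"
proof -
  have "0 \<le> t * ln t - t * ln (exp (- \<epsilon> * (norm x)\<^sup>2)) - t + exp (- \<epsilon> * (norm x)\<^sup>2)"
    using entropy_ge_tangent[OF assms, of "exp (- \<epsilon> * (norm x)\<^sup>2)"]
    by (rule order_trans[OF zero_le_power2]) simp
  then show ?thesis
    by (simp add: algebra_simps)
qed

lemma P2_density_integrable:
  fixes f :: "'a::euclidean_space \<Rightarrow> real"
  assumes [measurable]: "f \<in> borel_measurable borel" and "\<And>x. 0 \<le> f x"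
    and "density lborel f \<in> P2"
  shows "integrable lborel f" "integral\<^sup>L lborel f = 1" "integrable lborel (\<lambda>x. f x * (norm x)\<^sup>2)"
    "second_moment (density lborel f) = ennreal (\<integral>x. f x * (norm x)\<^sup>2 \<partial>lborel)"
proof -
  have *: "(\<integral>\<^sup>+ x. f x \<partial>lborel) = 1" "(\<integral>\<^sup>+ x. ennreal (f x * (norm x)\<^sup>2) \<partial>lborel) < \<infinity>"
    using assms by (simp_all add: density_P2_iff ennreal_mult)
  show i: "integrable lborel f" "integrable lborel (\<lambda>x. f x * (norm x)\<^sup>2)"
    using * assms(2) by (auto intro!: integrableI_nonneg)
  show "integral\<^sup>L lborel f = 1"
    using * assms(2) by (simp add: integral_eq_nn_integral)
  show "second_moment (density lborel f) = ennreal (\<integral>x. f x * (norm x)\<^sup>2 \<partial>lborel)"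
    using assms(2) i by (simp add: second_moment_def nn_integral_density nn_integral_eq_integral ennreal_mult[symmetric])
qed

text \<open>On \<open>P2\<close> the negative part of \<open>f * ln f\<close> is always integrable,
  by the Gaussian bound with \<open>\<epsilon> = 1\<close>; hence the assumption concerns the
  positive part alone.\<close>

lemma integrable_entropy:
  fixes f :: "'a::euclidean_space \<Rightarrow> real"
  assumes [measurable]: "f \<in> borel_measurable borel" and nonneg: "\<And>x. 0 \<le> f x"
    and P2: "density lborel f \<in> P2" and fin: "(\<integral>\<^sup>+ x. ennreal (f x * ln (f x)) \<partial>lborel) < \<infinity>"
  shows "integrable lborel (\<lambda>x. f x * ln (f x))"
proof -
  let ?b = "\<lambda>x. f x * (norm x)\<^sup>2 + exp (- 1 * (norm x)\<^sup>2)"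
  have "(\<integral>\<^sup>+ x. ennreal (- (f x * ln (f x))) \<partial>lborel) \<le> (\<integral>\<^sup>+ x. ennreal (?b x) \<partial>lborel)"
  proof (intro nn_integral_mono ennreal_leI)
    fix x
    show "- (f x * ln (f x)) \<le> ?b x"
      using entropy_gaussian_nonneg[OF nonneg[of x], of 1 x] nonneg[of x] by simp
  qed
  also have "\<dots> < \<infinity>"
  proof -
    have "integrable lborel ?b"
      using P2_density_integrable[OF _ _ P2] nonneg integrable_gaussian[of 1, where 'a='a]
      by (intro Bochner_Integration.integrable_add) auto
    then show ?thesis
      using nonneg by (simp add: integrable_iff_bounded)
  qed
  finally show ?thesis
    using fin by (simp add: real_integrable_def less_top)
qed

subsection \<open>Densities of finite entropy\<close>

text \<open>Representatives of the measures with finite entropy, required to vanish at every point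
  outside \<open>\<Omega>\<close> rather than almost everywhere. Integrals over
  \<open>\<Omega>\<close> and over the whole space then agree, and midpoints keep the support
  condition literally.\<close>

definition finite_entropy_density :: "'a::euclidean_space set \<Rightarrow> ('a \<Rightarrow> real) \<Rightarrow> bool"
  where "finite_entropy_density \<Omega> f \<longleftrightarrow>
    f \<in> borel_measurable borel \<and> (\<forall>x. 0 \<le> f x) \<and> (\<forall>x. x \<notin> \<Omega> \<longrightarrow> f x = 0) \<and>
    density lborel f \<in> P2 \<and> integrable lborel (\<lambda>x. f x * ln (f x))"

lemma finite_entropy_densityD:
  assumes "finite_entropy_density \<Omega> f"
  shows "f \<in> borel_measurable borel" "\<And>x. 0 \<le> f x" "\<And>x. x \<notin> \<Omega> \<Longrightarrow> f x = 0"
    "density lborel f \<in> P2" "integrable lborel (\<lambda>x. f x * ln (f x))"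
    "integrable lborel f" "integral\<^sup>L lborel f = 1" "integrable lborel (\<lambda>x. f x * (norm x)\<^sup>2)"
    "second_moment (density lborel f) = ennreal (\<integral>x. f x * (norm x)\<^sup>2 \<partial>lborel)"
proof -
  show *: "f \<in> borel_measurable borel" "\<And>x. 0 \<le> f x" "\<And>x. x \<notin> \<Omega> \<Longrightarrow> f x = 0"
    "density lborel f \<in> P2" "integrable lborel (\<lambda>x. f x * ln (f x))"
    using assms by (simp_all add: finite_entropy_density_def)
  show "integrable lborel f" "integral\<^sup>L lborel f = 1" "integrable lborel (\<lambda>x. f x * (norm x)\<^sup>2)"
    "second_moment (density lborel f) = ennreal (\<integral>x. f x * (norm x)\<^sup>2 \<partial>lborel)"
    by (rule P2_density_integrable[OF *(1,2,4)])+
qed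

lemma Ent_finite_entropy_density:
  assumes "finite_entropy_density \<Omega> f"
  shows "Ent \<Omega> (density lborel f) = ereal (\<integral>x. f x * ln (f x) \<partial>lborel)"
proof -
  note f = finite_entropy_densityD[OF assms]
  have "(\<integral>\<^sup>+ x. ennreal (f x) \<partial>lborel) = 1"
    using f by (simp add: nn_integral_eq_integral)
  moreover have "(\<integral>\<^sup>+ x\<in>\<Omega>. ennreal (f x) \<partial>lborel) = (\<integral>\<^sup>+ x. ennreal (f x) \<partial>lborel)"
    using f(3) by (intro nn_integral_cong) (auto simp: indicator_def)
  ultimately have "Ent \<Omega> (density lborel f) = extended_integral lborel \<Omega> (\<lambda>x. f x * ln (f x))"
    using f by (intro Ent_density) auto
  also have "\<dots> = enn2ereal (\<integral>\<^sup>+ x. ennreal (f x * ln (f x)) \<partial>lborel) - enn2ereal (\<integral>\<^sup>+ x. ennreal (- (f x * ln (f x))) \<partial>lborel)"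
    unfolding extended_integral_def using f(3)
    by (intro arg_cong2[where f=minus] arg_cong[where f=enn2ereal] nn_integral_cong) (auto simp: indicator_def)
  also have "\<dots> = ereal (\<integral>x. f x * ln (f x) \<partial>lborel)"
  proof -
    have "(\<integral>\<^sup>+ x. ennreal (f x * ln (f x)) \<partial>lborel) < top" "(\<integral>\<^sup>+ x. ennreal (- (f x * ln (f x))) \<partial>lborel) < top"
      using f(5) by (auto simp: real_integrable_def less_top)
    then obtain a b where "0 \<le> a" "(\<integral>\<^sup>+ x. ennreal (f x * ln (f x)) \<partial>lborel) = ennreal a"
      and "0 \<le> b" "(\<integral>\<^sup>+ x. ennreal (- (f x * ln (f x))) \<partial>lborel) = ennreal b"
      unfolding less_top_ennreal by blast
    then show ?thesis
      by (simp add: real_lebesgue_integral_def[OF f(5)])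
  qed
  finally show ?thesis .
qed

lemma Ent_finite_imp_density:
  fixes \<mu> :: "'a::euclidean_space measure"
  assumes "\<mu> \<in> P2" and fin: "Ent \<Omega> \<mu> \<noteq> \<infinity>" and [measurable]: "\<Omega> \<in> sets borel"
  obtains f where "finite_entropy_density \<Omega> f" "\<mu> = density lborel f"
proof -
  define \<sigma> where "\<sigma> = (\<lambda>x. enn2real (RN_deriv lborel \<mu> x))"
  have [measurable]: "\<sigma> \<in> borel_measurable borel"
    unfolding \<sigma>_def using borel_measurable_RN_deriv[of lborel \<mu>] by simp
  have nonneg: "0 \<le> \<sigma> x" for x
    by (simp add: \<sigma>_def)
  have \<mu>: "density lborel (\<lambda>x. ennreal (\<sigma> x)) = \<mu>" and mass: "(\<integral>\<^sup>+ x\<in>\<Omega>. ennreal (\<sigma> x) \<partial>lborel) = 1"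
    and ext: "extended_integral lborel \<Omega> (\<lambda>x. \<sigma> x * ln (\<sigma> x)) \<noteq> \<infinity>"
    using fin unfolding Ent_def Let_def \<sigma>_def[symmetric] by (auto split: if_splits)
  \<comment> \<open>Cutting the derivative to \<open>\<Omega>\<close> alters it only on a null set,
    since its mass on \<open>\<Omega>\<close> and its total mass are both 1.\<close>
  define f where "f x = indicator \<Omega> x * \<sigma> x" for x
  have [measurable]: "f \<in> borel_measurable borel"
    unfolding f_def by measurable
  have "AE x in lborel. \<sigma> x = f x"
  proof -
    have one: "(\<integral>\<^sup>+ x. ennreal (\<sigma> x) \<partial>lborel) = 1"
      using assms(1) unfolding \<mu>[symmetric] by (simp add: density_P2_iff)
    have "integrable lborel \<sigma>"
      using one nonneg by (intro integrableI_nonneg) auto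
    have "(\<integral>\<^sup>+ x. ennreal (f x) \<partial>lborel) = 1"
      unfolding mass[symmetric] f_def using nonneg by (intro nn_integral_cong) (auto simp: indicator_def)
    moreover have "(\<integral>\<^sup>+ x. ennreal (f x) \<partial>lborel) + (\<integral>\<^sup>+ x. ennreal (\<sigma> x - f x) \<partial>lborel) = (\<integral>\<^sup>+ x. ennreal (\<sigma> x) \<partial>lborel)"
      using nonneg by (subst nn_integral_add[symmetric]) (auto intro!: nn_integral_cong simp: f_def indicator_def)
    ultimately have "(\<integral>\<^sup>+ x. ennreal (\<sigma> x - f x) \<partial>lborel) = 0"
      using ennreal_add_left_cancel[of 1 "\<integral>\<^sup>+ x. ennreal (\<sigma> x - f x) \<partial>lborel" 0]
      unfolding one by simp
    then have "AE x in lborel. ennreal (\<sigma> x - f x) = 0"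
      by (subst (asm) nn_integral_0_iff_AE) auto
    then show ?thesis
    proof eventually_elim
      case (elim x)
      then have "\<sigma> x \<le> f x"
        by (simp add: ennreal_eq_0_iff)
      moreover have "f x \<le> \<sigma> x"
        using nonneg[of x] by (simp add: f_def indicator_def)
      ultimately show ?case
        by simp
    qed
  qed
  then have \<mu>f: "\<mu> = density lborel f"
    unfolding \<mu>[symmetric] by (intro density_cong) auto
  have "(\<integral>\<^sup>+ x. ennreal (f x * ln (f x)) \<partial>lborel) = (\<integral>\<^sup>+ x\<in>\<Omega>. ennreal (\<sigma> x * ln (\<sigma> x)) \<partial>lborel)"
    by (intro nn_integral_cong) (auto simp: f_def indicator_def)
  \<comment> \<open>In \<open>ereal\<close>, infinity minus any such integral is infinity, including
    infinity minus infinity. So a value other than infinity forces the positive part to be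
    finite.\<close>
  also have "\<dots> < \<infinity>"
    using ext unfolding extended_integral_def by (cases "\<integral>\<^sup>+ x\<in>\<Omega>. ennreal (\<sigma> x * ln (\<sigma> x)) \<partial>lborel" rule: ennreal_cases) auto
  finally have "integrable lborel (\<lambda>x. f x * ln (f x))"
    using assms(1) nonneg unfolding \<mu>f by (intro integrable_entropy) (auto simp: f_def)
  moreover have "density lborel f \<in> P2"
    using assms(1) unfolding \<mu>f .
  moreover have "0 \<le> f x" "x \<notin> \<Omega> \<longrightarrow> f x = 0" for x
    using nonneg by (simp_all add: f_def)
  ultimately have "finite_entropy_density \<Omega> f"
    by (simp add: finite_entropy_density_def)
  with \<mu>f show thesis
    by (rule that[rotated])
qed

text \<open>Trades the signed entropy for a nonnegative integrand to which Fatou applies. The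
  \<open>- 1\<close> is the mass of \<open>f\<close>.\<close>

lemma entropy_gaussian_integral:
  fixes f :: "'a::euclidean_space \<Rightarrow> real"
  assumes "finite_entropy_density \<Omega> f" "0 < \<epsilon>"
  defines "I \<equiv> (\<integral>x. f x * ln (f x) \<partial>lborel) + \<epsilon> * (\<integral>x. f x * (norm x)\<^sup>2 \<partial>lborel) - 1 +
      (\<integral>x. exp (- \<epsilon> * (norm (x :: 'a))\<^sup>2) \<partial>lborel)"
  shows "0 \<le> I"
    and "(\<integral>\<^sup>+ x. ennreal (f x * ln (f x) + \<epsilon> * (f x * (norm x)\<^sup>2) - f x + exp (- \<epsilon> * (norm x)\<^sup>2)) \<partial>lborel) = ennreal I"
proof -
  note f = finite_entropy_densityD[OF assms(1)] and g = integrable_gaussian[OF \<open>0 < \<epsilon>\<close>, where 'a='a]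
  let ?\<phi> = "\<lambda>x. f x * ln (f x) + \<epsilon> * (f x * (norm x)\<^sup>2) - f x + exp (- \<epsilon> * (norm x)\<^sup>2)"
  have int: "integrable lborel ?\<phi>"
    by (intro Bochner_Integration.integrable_add Bochner_Integration.integrable_diff integrable_mult_right f g)
  have nonneg: "0 \<le> ?\<phi> x" for x
    using f(2) by (rule entropy_gaussian_nonneg)
  have I: "integral\<^sup>L lborel ?\<phi> = I"
    unfolding I_def f(7)[symmetric]
    using f(5,6,8) g by simp
  show "0 \<le> I"
    unfolding I[symmetric] using nonneg by (intro Bochner_Integration.integral_nonneg)
  show "(\<integral>\<^sup>+ x. ennreal (?\<phi> x) \<partial>lborel) = ennreal I"
    unfolding I[symmetric] using int nonneg by (intro nn_integral_eq_integral) auto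
qed

lemma finite_entropy_density_midpoint:
  fixes f g :: "'a::euclidean_space \<Rightarrow> real"
  assumes "finite_entropy_density \<Omega> f" "finite_entropy_density \<Omega> g"
  defines "h \<equiv> \<lambda>x. (f x + g x) / 2"
  shows "finite_entropy_density \<Omega> h"
    and "integrable lborel (\<lambda>x. (sqrt (f x) - sqrt (g x))\<^sup>2)"
    and "(\<integral>x. h x * ln (h x) \<partial>lborel) + (\<integral>x. (sqrt (f x) - sqrt (g x))\<^sup>2 \<partial>lborel) / 4 \<le>
      ((\<integral>x. f x * ln (f x) \<partial>lborel) + (\<integral>x. g x * ln (g x) \<partial>lborel)) / 2"
proof -
  note f = finite_entropy_densityD[OF assms(1)] and g = finite_entropy_densityD[OF assms(2)]
  note [measurable] = f(1) g(1)
  have [measurable]: "h \<in> borel_measurable borel"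
    unfolding h_def by measurable
  have nonneg: "0 \<le> h x" for x
    using f(2)[of x] g(2)[of x] by (simp add: h_def)
  have h_int: "integrable lborel h" "integral\<^sup>L lborel h = 1"
    unfolding h_def using f(6,7) g(6,7) by simp_all
  have "integrable lborel (\<lambda>x. (f x * (norm x)\<^sup>2 + g x * (norm x)\<^sup>2) / 2)"
    using f(8) g(8) by simp
  then have "integrable lborel (\<lambda>x. h x * (norm x)\<^sup>2)"
    by (simp add: h_def add_divide_distrib distrib_right)
  then have P2: "density lborel h \<in> P2"
    using h_int nonneg by (simp add: density_P2_iff nn_integral_eq_integral ennreal_mult[symmetric])
  have gap: "h x * ln (h x) + (sqrt (f x) - sqrt (g x))\<^sup>2 / 4 \<le> (f x * ln (f x) + g x * ln (g x)) / 2" for x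
    unfolding h_def using f(2)[of x] g(2)[of x] by (rule entropy_midpoint_gap)
  have avg: "integrable lborel (\<lambda>x. (f x * ln (f x) + g x * ln (g x)) / 2)"
    using f(5) g(5) by simp
  have "(\<integral>\<^sup>+ x. ennreal (h x * ln (h x)) \<partial>lborel) \<le> (\<integral>\<^sup>+ x. ennreal \<bar>(f x * ln (f x) + g x * ln (g x)) / 2\<bar> \<partial>lborel)"
  proof (intro nn_integral_mono ennreal_leI)
    fix x
    show "h x * ln (h x) \<le> \<bar>(f x * ln (f x) + g x * ln (g x)) / 2\<bar>"
      using gap[of x] zero_le_power2[of "sqrt (f x) - sqrt (g x)"] by linarith
  qed
  also have "\<dots> < \<infinity>"
    using avg unfolding integrable_iff_bounded real_norm_def by blast
  finally have h_ln: "integrable lborel (\<lambda>x. h x * ln (h x))"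
    using P2 nonneg by (intro integrable_entropy) auto
  show "finite_entropy_density \<Omega> h"
    unfolding finite_entropy_density_def using h_ln P2 nonneg f(3) g(3) by (auto simp: h_def)
  show sq: "integrable lborel (\<lambda>x. (sqrt (f x) - sqrt (g x))\<^sup>2)"
  proof (rule Bochner_Integration.integrable_bound)
    show "integrable lborel (\<lambda>x. f x + g x)"
      using f(6) g(6) by simp
    show "AE x in lborel. norm ((sqrt (f x) - sqrt (g x))\<^sup>2) \<le> norm (f x + g x)"
      unfolding real_norm_def abs_of_nonneg[OF zero_le_power2]
      using f(2) g(2) by (intro AE_I2) (simp add: power2_diff)
  qed measurable
  have "(\<integral>x. h x * ln (h x) \<partial>lborel) + (\<integral>x. (sqrt (f x) - sqrt (g x))\<^sup>2 \<partial>lborel) / 4 =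
      (\<integral>x. h x * ln (h x) + (sqrt (f x) - sqrt (g x))\<^sup>2 / 4 \<partial>lborel)"
    using h_ln sq by simp
  also have "\<dots> \<le> (\<integral>x. (f x * ln (f x) + g x * ln (g x)) / 2 \<partial>lborel)"
    using h_ln sq avg gap by (intro integral_mono) auto
  also have "\<dots> = ((\<integral>x. f x * ln (f x) \<partial>lborel) + (\<integral>x. g x * ln (g x) \<partial>lborel)) / 2"
    using f(5) g(5) by simp
  finally show "(\<integral>x. h x * ln (h x) \<partial>lborel) + (\<integral>x. (sqrt (f x) - sqrt (g x))\<^sup>2 \<partial>lborel) / 4 \<le>
      ((\<integral>x. f x * ln (f x) \<partial>lborel) + (\<integral>x. g x * ln (g x) \<partial>lborel)) / 2" .
qed

text \<open>The uniform density on a ball inside \<open>\<Omega>\<close> has a single nonzero value,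
  so \<open>f * ln f\<close> is a multiple of \<open>f\<close>. It ensures that the infimum of the
  energy is not taken over an empty class.\<close>

lemma ex_finite_entropy_density:
  fixes \<Omega> :: "'a::euclidean_space set"
  assumes "open \<Omega>" "\<Omega> \<noteq> {}"
  obtains f where "finite_entropy_density \<Omega> f"
proof -
  obtain a e where "0 < e" and ball: "ball a e \<subseteq> \<Omega>"
    using assms by (meson all_not_in_conv openE)
  define v where "v = measure lborel (ball a e)"
  have em: "emeasure lborel (ball a e) = ennreal v"
    unfolding v_def using emeasure_bounded_finite[of "ball a e"] by (simp add: emeasure_eq_ennreal_measure less_top)
  have "0 < v"
    unfolding v_def using \<open>0 < e\<close> by (rule content_ball_pos)
  define f where "f x = indicator (ball a e) x / v" for x
  have [measurable]: "ball a e \<in> sets borel"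
    by simp
  have [measurable]: "f \<in> borel_measurable borel"
    unfolding f_def by simp
  have nonneg: "0 \<le> f x" for x
    using \<open>0 < v\<close> by (simp add: f_def)
  have "integrable lborel (\<lambda>x. indicator (ball a e) x :: real)"
    using em by (simp add: less_top)
  then have int: "integrable lborel f"
    unfolding f_def by simp
  have "(\<integral>\<^sup>+ x. ennreal (f x) \<partial>lborel) = (\<integral>\<^sup>+ x. ennreal (1 / v) * indicator (ball a e) x \<partial>lborel)"
    by (intro nn_integral_cong) (auto simp: f_def indicator_def)
  also have "\<dots> = 1"
    using em \<open>0 < v\<close> by (simp add: nn_integral_cmult ennreal_mult[symmetric])
  finally have mass: "(\<integral>\<^sup>+ x. ennreal (f x) \<partial>lborel) = 1" .
  have "(\<integral>\<^sup>+ x. ennreal (f x) * ennreal ((norm x)\<^sup>2) \<partial>lborel) \<le> (\<integral>\<^sup>+ x. ennreal (f x) * ennreal ((norm a + e)\<^sup>2) \<partial>lborel)"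
  proof (intro nn_integral_mono)
    fix x
    show "ennreal (f x) * ennreal ((norm x)\<^sup>2) \<le> ennreal (f x) * ennreal ((norm a + e)\<^sup>2)"
    proof (cases "x \<in> ball a e")
      case True
      then have "norm x \<le> norm a + e"
        using norm_triangle_sub[of x a] by (simp add: dist_norm norm_minus_commute)
      then have "(norm x)\<^sup>2 \<le> (norm a + e)\<^sup>2"
        by (intro power_mono) auto
      then show ?thesis
        by (intro mult_left_mono ennreal_leI) auto
    qed (simp add: f_def)
  qed
  also have "\<dots> < \<infinity>"
    using mass by (simp add: nn_integral_multc)
  finally have "density lborel f \<in> P2"
    using mass by (simp add: density_P2_iff)
  moreover have "integrable lborel (\<lambda>x. f x * ln (f x))"
  proof -
    have "(\<lambda>x. f x * ln (f x)) = (\<lambda>x. ln (1 / v) * f x)"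
      by (simp add: f_def indicator_def fun_eq_iff)
    then show ?thesis
      using int by (simp only: integrable_mult_right)
  qed
  moreover have "f x = 0" if "x \<notin> \<Omega>" for x
    using that ball by (auto simp: f_def indicator_def)
  ultimately have "finite_entropy_density \<Omega> f"
    using nonneg by (simp add: finite_entropy_density_def)
  then show thesis
    by (rule that)
qed

subsection \<open>The penalised energy\<close>

lemma mult_liminf_le_ennreal: "c * liminf x \<le> liminf (\<lambda>n. c * x n :: ennreal)"
  unfolding liminf_SUP_INF SUP_mult_left_ennreal
  by (intro SUP_mono' INF_greatest mult_left_mono INF_lower) auto

text \<open>Only the limit 0 is delicate, because \<open>ln\<close> is discontinuous there. With the
  convention \<open>ln 0 = 0\<close>, the product is squeezed between \<open>- (2 * sqrt t)\<close>
  and \<open>t\<^sup>2\<close>.\<close>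

lemma tendsto_mult_ln:
  fixes f :: "'b \<Rightarrow> real"
  assumes nonneg: "\<And>n. 0 \<le> f n" and lim: "(f \<longlongrightarrow> a) F" and "F \<noteq> bot"
  shows "((\<lambda>n. f n * ln (f n)) \<longlongrightarrow> a * ln a) F"
proof -
  have "0 \<le> a"
    using lim nonneg \<open>F \<noteq> bot\<close> by (intro tendsto_lowerbound[OF lim]) auto
  show ?thesis
  proof (cases "a = 0")
    case True
    have bound: "- (2 * sqrt t) \<le> t * ln t \<and> t * ln t \<le> t\<^sup>2" if "0 \<le> t" for t :: real
    proof (cases "t = 0")
      case False
      then have "0 < t"
        using that by simp
      have "ln (1 / sqrt t) \<le> 1 / sqrt t"
        using ln_le_minus_one[of "1 / sqrt t"] \<open>0 < t\<close> by simp
      then have "- ln t \<le> 2 * (1 / sqrt t)"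
        using \<open>0 < t\<close> by (simp add: ln_div ln_sqrt)
      then have "t * (- ln t) \<le> t * (2 * (1 / sqrt t))"
        using that by (intro mult_left_mono)
      also have "t * (2 * (1 / sqrt t)) = 2 * (t / sqrt t)"
        by simp
      also have "t / sqrt t = sqrt t"
        using that by (rule real_div_sqrt)
      finally have "- (2 * sqrt t) \<le> t * ln t"
        by simp
      moreover have "t * ln t \<le> t * t"
        using ln_le_minus_one[OF \<open>0 < t\<close>] that by (intro mult_left_mono) auto
      ultimately show ?thesis
        by (simp add: power2_eq_square)
    qed simp
    have "((\<lambda>n. f n * ln (f n)) \<longlongrightarrow> 0) F"
    proof (rule tendsto_sandwich)
      show "((\<lambda>n. - (2 * sqrt (f n))) \<longlongrightarrow> 0) F"
        using tendsto_minus[OF tendsto_mult[OF tendsto_const[of 2] tendsto_real_sqrt[OF lim]]] True by simp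
      show "((\<lambda>n. (f n)\<^sup>2) \<longlongrightarrow> 0) F"
        using tendsto_power[OF lim, of 2] True by simp
    qed (use bound nonneg in auto)
    then show ?thesis
      using True by simp
  next
    case False
    then show ?thesis
      by (intro tendsto_mult tendsto_ln lim)
  qed
qed

locale penalized_barycenter =
  fixes \<Omega> :: "'a::euclidean_space set" and lam :: real and P :: "'a measure measure"
  assumes nonempty: "\<Omega> \<noteq> {}" and open_domain: "open \<Omega>" and lam_pos: "0 < lam"
    and prob_P: "prob_space P" and sets_P: "sets P = sets borel_P2"
    and finite_P: "(\<integral>\<^sup>+ \<nu>. second_moment \<nu> \<partial>P) < \<infinity>"
begin

definition mean_cost :: "('a \<Rightarrow> real) \<Rightarrow> ennreal"
  where "mean_cost f = (\<integral>\<^sup>+ \<nu>. ennreal ((W2 (density lborel f) \<nu>)\<^sup>2) \<partial>P)"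

definition mean_second_moment :: real
  where "mean_second_moment = enn2real (\<integral>\<^sup>+ \<nu>. second_moment \<nu> \<partial>P)"

text \<open>The objective as a real number, for densities whose cost and entropy are both finite.
  Midpoint inequalities and infima are then handled by real arithmetic;
  \<open>objective_density\<close> leads back.\<close>

definition energy :: "('a \<Rightarrow> real) \<Rightarrow> real"
  where "energy f = enn2real (mean_cost f) / 2 + lam * (\<integral>x. f x * ln (f x) \<partial>lborel)"

lemma space_P: "space P = P2"
  using sets_eq_imp_space_eq[OF sets_P] by (simp add: space_borel_P2)

lemma measurable_P: "borel_measurable P = borel_measurable borel_P2"
  by (rule measurable_cong_sets) (simp_all add: sets_P)

lemma mean_second_moment: "(\<integral>\<^sup>+ \<nu>. second_moment \<nu> \<partial>P) = ennreal mean_second_moment"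
  using finite_P by (simp add: mean_second_moment_def)

lemma mean_second_moment_nonneg: "0 \<le> mean_second_moment"
  by (simp add: mean_second_moment_def)

text \<open>\<open>transport_cost \<mu>\<close> is known to coincide with the squared distance only
  on \<open>P2\<close>, which is the space of \<open>P\<close>; its measurability is inherited from
  \<open>W2 \<mu>\<close> in this way. The last two bounds average the moment estimates over the
  probability measure \<open>P\<close>.\<close>

lemma
  assumes "\<mu> \<in> P2"
  shows mean_W2_sq: "(\<integral>\<^sup>+ \<nu>. ennreal ((W2 \<mu> \<nu>)\<^sup>2) \<partial>P) = (\<integral>\<^sup>+ \<nu>. transport_cost \<mu> \<nu> \<partial>P)"
    and borel_measurable_transport_cost: "transport_cost \<mu> \<in> borel_measurable P"
    and mean_W2_sq_finite: "(\<integral>\<^sup>+ \<nu>. ennreal ((W2 \<mu> \<nu>)\<^sup>2) \<partial>P) < \<infinity>"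
    and second_moment_le_mean_W2_sq:
      "second_moment \<mu> \<le> 2 * (\<integral>\<^sup>+ \<nu>. ennreal ((W2 \<mu> \<nu>)\<^sup>2) \<partial>P) + 2 * ennreal mean_second_moment"
proof -
  interpret P: prob_space P by (rule prob_P)
  have [measurable]: "W2 \<mu> \<in> borel_measurable P" "second_moment \<in> borel_measurable P"
    unfolding measurable_P by (auto intro: borel_measurable_W2 borel_measurable_second_moment assms)
  have eq: "ennreal ((W2 \<mu> \<nu>)\<^sup>2) = transport_cost \<mu> \<nu>" if "\<nu> \<in> space P" for \<nu>
    using that assms by (simp add: space_P W2_sq)
  show mean: "(\<integral>\<^sup>+ \<nu>. ennreal ((W2 \<mu> \<nu>)\<^sup>2) \<partial>P) = (\<integral>\<^sup>+ \<nu>. transport_cost \<mu> \<nu> \<partial>P)"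
    by (rule nn_integral_cong) (rule eq)
  have "(\<lambda>\<nu>. ennreal ((W2 \<mu> \<nu>)\<^sup>2)) \<in> borel_measurable P"
    by measurable
  then show [measurable]: "transport_cost \<mu> \<in> borel_measurable P"
    by (subst measurable_cong[OF eq[symmetric]])
  have "(\<integral>\<^sup>+ \<nu>. transport_cost \<mu> \<nu> \<partial>P) \<le> (\<integral>\<^sup>+ \<nu>. 2 * second_moment \<mu> + 2 * second_moment \<nu> \<partial>P)"
    using assms by (intro nn_integral_mono transport_cost_le_second_moment) (auto simp: space_P)
  also have "\<dots> = 2 * second_moment \<mu> + 2 * ennreal mean_second_moment"
    by (simp add: nn_integral_add nn_integral_cmult mean_second_moment P.emeasure_space_1)
  also have "\<dots> < \<infinity>"
    using P2D(3)[OF assms] by (simp add: ennreal_mult_less_top)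
  finally show "(\<integral>\<^sup>+ \<nu>. ennreal ((W2 \<mu> \<nu>)\<^sup>2) \<partial>P) < \<infinity>"
    unfolding mean .
  have "second_moment \<mu> = (\<integral>\<^sup>+ \<nu>. second_moment \<mu> \<partial>P)"
    by (simp add: P.emeasure_space_1)
  also have "\<dots> \<le> (\<integral>\<^sup>+ \<nu>. 2 * transport_cost \<mu> \<nu> + 2 * second_moment \<nu> \<partial>P)"
    using assms by (intro nn_integral_mono second_moment_le_transport_cost) (auto simp: space_P)
  also have "\<dots> = 2 * (\<integral>\<^sup>+ \<nu>. ennreal ((W2 \<mu> \<nu>)\<^sup>2) \<partial>P) + 2 * ennreal mean_second_moment"
    unfolding mean by (simp add: nn_integral_add nn_integral_cmult mean_second_moment)
  finally show "second_moment \<mu> \<le> 2 * (\<integral>\<^sup>+ \<nu>. ennreal ((W2 \<mu> \<nu>)\<^sup>2) \<partial>P) + 2 * ennreal mean_second_moment" .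
qed

lemma mean_cost_eq:
  assumes "finite_entropy_density \<Omega> f"
  shows "mean_cost f = ennreal (enn2real (mean_cost f))"
  using mean_W2_sq_finite[OF finite_entropy_densityD(4)[OF assms]] by (simp add: mean_cost_def)

lemma objective_density:
  assumes "finite_entropy_density \<Omega> f"
  shows "objective \<Omega> lam P (density lborel f) = ereal (energy f)"
proof -
  have "enn2ereal (mean_cost f) = ereal (enn2real (mean_cost f))"
    by (subst mean_cost_eq[OF assms]) (simp add: enn2ereal_ennreal)
  then show ?thesis
    by (simp add: objective_def Ent_finite_entropy_density[OF assms] energy_def mean_cost_def)
qed

lemma objective_finite_imp_density:
  assumes "\<mu> \<in> P2" "objective \<Omega> lam P \<mu> \<noteq> \<infinity>"
  obtains f where "finite_entropy_density \<Omega> f" "\<mu> = density lborel f"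
proof (rule Ent_finite_imp_density[OF assms(1)])
  show "\<Omega> \<in> sets borel"
    using open_domain by simp
  show "Ent \<Omega> \<mu> \<noteq> \<infinity>"
  proof
    assume "Ent \<Omega> \<mu> = \<infinity>"
    then have "objective \<Omega> lam P \<mu> = \<infinity>"
      using lam_pos by (simp add: objective_def)
    with assms(2) show False ..
  qed
qed

lemma mean_cost_midpoint:
  assumes "finite_entropy_density \<Omega> f" "finite_entropy_density \<Omega> g"
  shows "enn2real (mean_cost (\<lambda>x. (f x + g x) / 2)) \<le> (enn2real (mean_cost f) + enn2real (mean_cost g)) / 2"
proof -
  note f = finite_entropy_densityD[OF assms(1)] and g = finite_entropy_densityD[OF assms(2)]
  note [measurable] = f(1) g(1)
  have h: "finite_entropy_density \<Omega> (\<lambda>x. (f x + g x) / 2)"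
    by (rule finite_entropy_density_midpoint) fact+
  have mid: "emeasure (density lborel (\<lambda>x. (f x + g x) / 2)) A =
      ennreal (1 / 2) * emeasure (density lborel f) A + ennreal (1 / 2) * emeasure (density lborel g) A"
    if [measurable]: "A \<in> sets borel" for A
  proof -
    have "ennreal ((f x + g x) / 2) * indicator A x =
        ennreal (1 / 2) * (ennreal (f x) * indicator A x) + ennreal (1 / 2) * (ennreal (g x) * indicator A x)" for x
    proof -
      have "ennreal ((f x + g x) / 2) = ennreal (1 / 2 * f x + 1 / 2 * g x)"
        by (simp add: add_divide_distrib)
      also have "\<dots> = ennreal (1 / 2) * ennreal (f x) + ennreal (1 / 2) * ennreal (g x)"
        using f(2)[of x] g(2)[of x] by (subst ennreal_plus) (auto simp: ennreal_mult'' simp del: times_divide_eq_left)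
      finally show ?thesis
        by (simp only: distrib_right mult.assoc)
    qed
    then show ?thesis
      by (simp add: emeasure_density nn_integral_add nn_integral_cmult del: ennreal_half)
  qed
  have "mean_cost (\<lambda>x. (f x + g x) / 2) = (\<integral>\<^sup>+ \<nu>. transport_cost (density lborel (\<lambda>x. (f x + g x) / 2)) \<nu> \<partial>P)"
    unfolding mean_cost_def by (rule mean_W2_sq[OF finite_entropy_densityD(4)[OF h]])
  also have "\<dots> \<le> (\<integral>\<^sup>+ \<nu>. ennreal (1 / 2) * transport_cost (density lborel f) \<nu> +
      ennreal (1 / 2) * transport_cost (density lborel g) \<nu> \<partial>P)"
    by (intro nn_integral_mono transport_cost_midpoint_le mid finite_entropy_densityD(4)[OF h] f(4) g(4))
      (auto simp: space_P)
  also have "\<dots> = ennreal (1 / 2) * mean_cost f + ennreal (1 / 2) * mean_cost g"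
    unfolding mean_cost_def mean_W2_sq[OF f(4)] mean_W2_sq[OF g(4)]
    using borel_measurable_transport_cost[OF f(4)] borel_measurable_transport_cost[OF g(4)]
    by (simp add: nn_integral_add nn_integral_cmult del: ennreal_half)
  also have "\<dots> = ennreal (1 / 2 * enn2real (mean_cost f) + 1 / 2 * enn2real (mean_cost g))"
    by (subst mean_cost_eq[OF assms(1)], subst mean_cost_eq[OF assms(2)], subst ennreal_plus)
      (auto simp: ennreal_mult'' simp del: times_divide_eq_left)
  finally have "ennreal (enn2real (mean_cost (\<lambda>x. (f x + g x) / 2))) \<le> ennreal (1 / 2 * enn2real (mean_cost f) + 1 / 2 * enn2real (mean_cost g))"
    unfolding mean_cost_eq[OF h, symmetric] .
  then show ?thesis
    by (subst (asm) ennreal_le_iff) (auto simp: add_divide_distrib)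
qed

lemma energy_midpoint_gap:
  assumes "finite_entropy_density \<Omega> f" "finite_entropy_density \<Omega> g"
  shows "energy (\<lambda>x. (f x + g x) / 2) + lam / 4 * (\<integral>x. (sqrt (f x) - sqrt (g x))\<^sup>2 \<partial>lborel) \<le>
    (energy f + energy g) / 2"
proof -
  have "lam * ((\<integral>x. (f x + g x) / 2 * ln ((f x + g x) / 2) \<partial>lborel) +
      (\<integral>x. (sqrt (f x) - sqrt (g x))\<^sup>2 \<partial>lborel) / 4) \<le>
      lam * (((\<integral>x. f x * ln (f x) \<partial>lborel) + (\<integral>x. g x * ln (g x) \<partial>lborel)) / 2)"
    using finite_entropy_density_midpoint(3)[OF assms] lam_pos by (intro mult_left_mono) auto
  with mean_cost_midpoint[OF assms] show ?thesis
    unfolding energy_def by (simp add: field_simps)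
qed

section \<open>Coercivity, lower semicontinuity and the minimiser\<close>

lemma energy_coercive:
  obtains C where "\<And>f. finite_entropy_density \<Omega> f \<Longrightarrow> (\<integral>x. f x * (norm x)\<^sup>2 \<partial>lborel) \<le> 8 * energy f + C"
    and "\<And>f. finite_entropy_density \<Omega> f \<Longrightarrow> - C \<le> 8 * energy f"
proof -
  \<comment> \<open>Eight times the energy is four times the mean cost plus \<open>8 * lam\<close>
    times the entropy. The cost part yields twice the second moment up to a constant, while the
    Gaussian bound with \<open>lam * \<epsilon> = 1 / 8\<close> gives back only one moment, so one
    remains.\<close>
  define \<epsilon> where "\<epsilon> = 1 / (8 * lam)"
  have \<epsilon>: "0 < \<epsilon>" "lam * \<epsilon> = 1 / 8"
    using lam_pos by (simp_all add: \<epsilon>_def)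
  define G where "G = (\<integral>x. exp (- \<epsilon> * (norm (x :: 'a))\<^sup>2) \<partial>lborel)"
  define C where "C = 4 * mean_second_moment + 8 * lam * (G - 1)"
  have bound: "(\<integral>x. f x * (norm x)\<^sup>2 \<partial>lborel) \<le> 8 * energy f + C" if "finite_entropy_density \<Omega> f" for f
  proof -
    note f = finite_entropy_densityD[OF that]
    let ?m = "\<integral>x. f x * (norm x)\<^sup>2 \<partial>lborel" and ?V = "enn2real (mean_cost f)"
    have "ennreal ?m \<le> 2 * mean_cost f + 2 * ennreal mean_second_moment"
      using second_moment_le_mean_W2_sq[OF f(4)] unfolding f(9) mean_cost_def .
    also have "\<dots> = 2 * ennreal ?V + 2 * ennreal mean_second_moment"
      by (subst mean_cost_eq[OF that]) simp
    also have "\<dots> = ennreal (2 * ?V + 2 * mean_second_moment)"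
      using mean_second_moment_nonneg by (simp add: ennreal_mult'')
    finally have m: "?m \<le> 2 * ?V + 2 * mean_second_moment"
      using mean_second_moment_nonneg by (subst (asm) ennreal_le_iff) auto
    have "0 \<le> lam * ((\<integral>x. f x * ln (f x) \<partial>lborel) + \<epsilon> * ?m - 1 + G)"
      using entropy_gaussian_integral(1)[OF that \<epsilon>(1)] lam_pos unfolding G_def
      by (intro mult_nonneg_nonneg) auto
    also have "\<dots> = lam * (\<integral>x. f x * ln (f x) \<partial>lborel) + (lam * \<epsilon>) * ?m + lam * (G - 1)"
      by (simp add: algebra_simps)
    finally show ?thesis
      using m unfolding \<epsilon>(2) energy_def C_def by (simp add: field_simps)
  qed
  moreover have "- C \<le> 8 * energy f" if "finite_entropy_density \<Omega> f" for f
  proof -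
    have "0 \<le> (\<integral>x. f x * (norm x)\<^sup>2 \<partial>lborel)"
      using finite_entropy_densityD(2)[OF that] by (intro Bochner_Integration.integral_nonneg) auto
    then show ?thesis
      using bound[OF that] by linarith
  qed
  ultimately show thesis
    by (rule that)
qed

text \<open>Cost and Gaussian-shifted entropy are both nonnegative, so Fatou bounds their sum at
  \<open>g\<close> for each fixed \<open>\<epsilon>\<close>. The bound contains
  \<open>\<epsilon> * M\<close> in place of the moment of \<open>g\<close>; the mismatch disappears
  as \<open>\<epsilon>\<close> tends to 0.\<close>

lemma energy_limit:
  assumes f: "\<And>n. finite_entropy_density \<Omega> (f n)"
    and [measurable]: "g \<in> borel_measurable borel" and nonneg: "\<And>x. 0 \<le> g x"
    and zero: "\<And>x. x \<notin> \<Omega> \<Longrightarrow> g x = 0" and mass: "(\<integral>\<^sup>+ x. ennreal (g x) \<partial>lborel) = 1"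
    and lim: "AE x in lborel. (\<lambda>n. f n x) \<longlonglongrightarrow> g x"
    and energy_le: "\<And>n. energy (f n) \<le> c + \<delta> n" and \<delta>: "\<delta> \<longlonglongrightarrow> 0"
    and M: "\<And>n. (\<integral>x. f n x * (norm x)\<^sup>2 \<partial>lborel) \<le> M"
  shows "finite_entropy_density \<Omega> g" and "energy g \<le> c"
proof -
  note fD = finite_entropy_densityD[OF f]
  note [measurable] = fD(1)
  let ?\<phi> = "\<lambda>\<epsilon> f x. f x * ln (f x) + \<epsilon> * (f x * (norm (x :: 'a))\<^sup>2) - f x + exp (- \<epsilon> * (norm x)\<^sup>2)"
  define G where "G \<epsilon> = (\<integral>x. exp (- \<epsilon> * (norm (x :: 'a))\<^sup>2) \<partial>lborel)" for \<epsilon>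
  define E where "E f = (\<integral>x. f x * ln (f x) \<partial>lborel)" for f :: "'a \<Rightarrow> real"
  have "(\<integral>\<^sup>+ x. ennreal (g x) * ennreal ((norm x)\<^sup>2) \<partial>lborel) \<le> ennreal M"
  proof -
    have "(\<integral>\<^sup>+ x. ennreal (g x) * ennreal ((norm x)\<^sup>2) \<partial>lborel) =
        (\<integral>\<^sup>+ x. liminf (\<lambda>n. ennreal (f n x * (norm x)\<^sup>2)) \<partial>lborel)"
    proof (rule nn_integral_cong_AE)
      show "AE x in lborel. ennreal (g x) * ennreal ((norm x)\<^sup>2) = liminf (\<lambda>n. ennreal (f n x * (norm x)\<^sup>2))"
        using lim
      proof eventually_elim
        case (elim x)
        have "(\<lambda>n. ennreal (f n x * (norm x)\<^sup>2)) \<longlonglongrightarrow> ennreal (g x * (norm x)\<^sup>2)"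
          by (intro tendsto_ennrealI tendsto_intros elim)
        then show ?case
          using nonneg by (simp add: lim_imp_Liminf ennreal_mult)
      qed
    qed
    also have "\<dots> \<le> liminf (\<lambda>n. \<integral>\<^sup>+ x. ennreal (f n x * (norm x)\<^sup>2) \<partial>lborel)"
      by (rule nn_integral_liminf) simp
    also have "\<dots> \<le> ennreal M"
    proof -
      have "(\<integral>\<^sup>+ x. ennreal (f n x * (norm x)\<^sup>2) \<partial>lborel) \<le> ennreal M" for n
        using fD(2,8) M by (subst nn_integral_eq_integral) (auto intro: ennreal_leI)
      then have "liminf (\<lambda>n. \<integral>\<^sup>+ x. ennreal (f n x * (norm x)\<^sup>2) \<partial>lborel) \<le> liminf (\<lambda>n. ennreal M)"
        by (intro Liminf_mono always_eventually) auto
      then show ?thesis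
        by (simp add: Liminf_const)
    qed
    finally show ?thesis .
  qed
  then have P2: "density lborel g \<in> P2"
    using mass by (auto simp: density_P2_iff intro: le_less_trans)
  have "mean_cost g \<le> liminf (\<lambda>n. mean_cost (f n))"
  proof -
    have "mean_cost g = (\<integral>\<^sup>+ \<nu>. transport_cost (density lborel g) \<nu> \<partial>P)"
      unfolding mean_cost_def by (rule mean_W2_sq[OF P2])
    also have "\<dots> \<le> (\<integral>\<^sup>+ \<nu>. liminf (\<lambda>n. transport_cost (density lborel (f n)) \<nu>) \<partial>P)"
      using lim nonneg P2 fD(2,4) by (intro nn_integral_mono transport_cost_le_liminf) (auto simp: space_P)
    also have "\<dots> \<le> liminf (\<lambda>n. \<integral>\<^sup>+ \<nu>. transport_cost (density lborel (f n)) \<nu> \<partial>P)"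
      by (rule nn_integral_liminf) (rule borel_measurable_transport_cost[OF fD(4)])
    finally show ?thesis
      unfolding mean_cost_def mean_W2_sq[OF fD(4)] .
  qed
  then have cost: "ennreal (1 / 2) * mean_cost g \<le> liminf (\<lambda>n. ennreal (1 / 2) * mean_cost (f n))"
    by (intro order_trans[OF mult_left_mono mult_liminf_le_ennreal]) auto
  \<comment> \<open>Stated in \<open>ennreal\<close>, hence meaningful before the entropy of
    \<open>g\<close> is known to be finite; its instance \<open>\<epsilon> = 1\<close> then supplies
    that finiteness.\<close>
  have total: "ennreal (1 / 2) * mean_cost g + ennreal lam * (\<integral>\<^sup>+ x. ennreal (?\<phi> \<epsilon> g x) \<partial>lborel) \<le>
      ennreal (c + lam * (\<epsilon> * M - 1 + G \<epsilon>))" if "0 < \<epsilon>" for \<epsilon>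
  proof -
    note gauss = entropy_gaussian_integral[OF f that, folded G_def E_def]
    have "(\<integral>\<^sup>+ x. ennreal (?\<phi> \<epsilon> g x) \<partial>lborel) = (\<integral>\<^sup>+ x. liminf (\<lambda>n. ennreal (?\<phi> \<epsilon> (f n) x)) \<partial>lborel)"
    proof (rule nn_integral_cong_AE)
      show "AE x in lborel. ennreal (?\<phi> \<epsilon> g x) = liminf (\<lambda>n. ennreal (?\<phi> \<epsilon> (f n) x))"
        using lim
      proof eventually_elim
        case (elim x)
        have "(\<lambda>n. f n x * ln (f n x)) \<longlonglongrightarrow> g x * ln (g x)"
          by (rule tendsto_mult_ln[OF _ elim]) (auto intro: fD(2))
        moreover have "(\<lambda>n. \<epsilon> * (f n x * (norm x)\<^sup>2)) \<longlonglongrightarrow> \<epsilon> * (g x * (norm x)\<^sup>2)"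
          by (intro tendsto_intros elim)
        ultimately have "(\<lambda>n. ennreal (?\<phi> \<epsilon> (f n) x)) \<longlonglongrightarrow> ennreal (?\<phi> \<epsilon> g x)"
          using elim by (intro tendsto_ennrealI tendsto_add[OF tendsto_diff[OF tendsto_add] tendsto_const])
        then show ?case
          by (simp add: lim_imp_Liminf)
      qed
    qed
    also have "\<dots> \<le> liminf (\<lambda>n. \<integral>\<^sup>+ x. ennreal (?\<phi> \<epsilon> (f n) x) \<partial>lborel)"
      by (rule nn_integral_liminf) simp
    finally have "ennreal lam * (\<integral>\<^sup>+ x. ennreal (?\<phi> \<epsilon> g x) \<partial>lborel) \<le>
        liminf (\<lambda>n. ennreal lam * (\<integral>\<^sup>+ x. ennreal (?\<phi> \<epsilon> (f n) x) \<partial>lborel))"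
      by (intro order_trans[OF mult_left_mono mult_liminf_le_ennreal]) auto
    with cost have "ennreal (1 / 2) * mean_cost g + ennreal lam * (\<integral>\<^sup>+ x. ennreal (?\<phi> \<epsilon> g x) \<partial>lborel) \<le>
        liminf (\<lambda>n. ennreal (1 / 2) * mean_cost (f n)) +
        liminf (\<lambda>n. ennreal lam * (\<integral>\<^sup>+ x. ennreal (?\<phi> \<epsilon> (f n) x) \<partial>lborel))"
      by (rule add_mono)
    also have "\<dots> \<le> liminf (\<lambda>n. ennreal (1 / 2) * mean_cost (f n) + ennreal lam * (\<integral>\<^sup>+ x. ennreal (?\<phi> \<epsilon> (f n) x) \<partial>lborel))"
      by (rule liminf_add_le_ennreal)
    also have "\<dots> \<le> liminf (\<lambda>n. ennreal (c + \<delta> n + lam * (\<epsilon> * M - 1 + G \<epsilon>)))"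
    proof (intro Liminf_mono always_eventually allI)
      fix n
      let ?m = "\<integral>x. f n x * (norm x)\<^sup>2 \<partial>lborel" and ?V = "enn2real (mean_cost (f n))"
      have "ennreal (1 / 2) * mean_cost (f n) + ennreal lam * (\<integral>\<^sup>+ x. ennreal (?\<phi> \<epsilon> (f n) x) \<partial>lborel) =
          ennreal (1 / 2) * ennreal ?V + ennreal lam * ennreal (E (f n) + \<epsilon> * ?m - 1 + G \<epsilon>)"
        unfolding gauss(2) mean_cost_eq[OF f, symmetric] ..
      also have "\<dots> = ennreal (1 / 2 * ?V + lam * (E (f n) + \<epsilon> * ?m - 1 + G \<epsilon>))"
        using lam_pos gauss(1)[of n] by (subst ennreal_plus) (auto simp: ennreal_mult simp del: times_divide_eq_left)
      also have "1 / 2 * ?V + lam * (E (f n) + \<epsilon> * ?m - 1 + G \<epsilon>) = energy (f n) + lam * (\<epsilon> * ?m - 1 + G \<epsilon>)"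
        by (simp add: energy_def E_def algebra_simps)
      also have "\<dots> \<le> c + \<delta> n + lam * (\<epsilon> * M - 1 + G \<epsilon>)"
        using energy_le[of n] M[of n] lam_pos \<open>0 < \<epsilon>\<close> by (intro add_mono mult_left_mono diff_mono) auto
      finally show "ennreal (1 / 2) * mean_cost (f n) + ennreal lam * (\<integral>\<^sup>+ x. ennreal (?\<phi> \<epsilon> (f n) x) \<partial>lborel) \<le>
          ennreal (c + \<delta> n + lam * (\<epsilon> * M - 1 + G \<epsilon>))"
        by (simp add: ennreal_leI)
    qed
    also have "\<dots> = ennreal (c + 0 + lam * (\<epsilon> * M - 1 + G \<epsilon>))"
      by (intro lim_imp_Liminf tendsto_ennrealI tendsto_intros \<delta>) simp
    finally show ?thesis
      by simp
  qed
  have "(\<integral>\<^sup>+ x. ennreal (g x * ln (g x)) \<partial>lborel) \<le> (\<integral>\<^sup>+ x. ennreal (?\<phi> 1 g x) + ennreal (g x) \<partial>lborel)"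
  proof (rule nn_integral_mono)
    fix x :: 'a
    have "ennreal (g x * ln (g x)) \<le> ennreal (?\<phi> 1 g x + g x)"
      using nonneg[of x] by (intro ennreal_leI) simp
    also have "\<dots> = ennreal (?\<phi> 1 g x) + ennreal (g x)"
      using entropy_gaussian_nonneg[OF nonneg[of x], of 1 x] nonneg[of x] by (rule ennreal_plus)
    finally show "ennreal (g x * ln (g x)) \<le> ennreal (?\<phi> 1 g x) + ennreal (g x)" .
  qed
  also have "\<dots> = (\<integral>\<^sup>+ x. ennreal (?\<phi> 1 g x) \<partial>lborel) + 1"
    unfolding mass[symmetric] by (rule nn_integral_add) auto
  also have "\<dots> < \<infinity>"
  proof -
    have "ennreal lam * (\<integral>\<^sup>+ x. ennreal (?\<phi> 1 g x) \<partial>lborel) \<le>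
        ennreal (1 / 2) * mean_cost g + ennreal lam * (\<integral>\<^sup>+ x. ennreal (?\<phi> 1 g x) \<partial>lborel)"
      by (simp add: add_increasing)
    also have "\<dots> \<le> ennreal (c + lam * (1 * M - 1 + G 1))"
      by (rule total) simp
    also have "\<dots> < \<infinity>"
      by simp
    finally show ?thesis
      using lam_pos by (auto simp: ennreal_mult_less_top)
  qed
  finally have "integrable lborel (\<lambda>x. g x * ln (g x))"
    using P2 nonneg by (intro integrable_entropy) auto
  then show g: "finite_entropy_density \<Omega> g"
    using P2 nonneg zero by (simp add: finite_entropy_density_def)
  have g_le: "energy g \<le> c + \<epsilon> * (lam * (M - (\<integral>x. g x * (norm x)\<^sup>2 \<partial>lborel)))" if "0 < \<epsilon>" for \<epsilon>
  proof -
    note gauss = entropy_gaussian_integral[OF g that, folded G_def E_def]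
    let ?m = "\<integral>x. g x * (norm x)\<^sup>2 \<partial>lborel" and ?V = "enn2real (mean_cost g)"
    have "ennreal (1 / 2 * ?V + lam * (E g + \<epsilon> * ?m - 1 + G \<epsilon>)) =
        ennreal (1 / 2) * ennreal ?V + ennreal lam * ennreal (E g + \<epsilon> * ?m - 1 + G \<epsilon>)"
      using lam_pos gauss(1) by (subst ennreal_plus) (auto simp: ennreal_mult simp del: times_divide_eq_left)
    also have "\<dots> \<le> ennreal (c + lam * (\<epsilon> * M - 1 + G \<epsilon>))"
      using total[OF that] unfolding gauss(2) mean_cost_eq[OF g, symmetric] .
    finally have le: "ennreal (1 / 2 * ?V + lam * (E g + \<epsilon> * ?m - 1 + G \<epsilon>)) \<le> ennreal (c + lam * (\<epsilon> * M - 1 + G \<epsilon>))" .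
    \<comment> \<open>\<open>ennreal\<close> sends negative numbers to 0, so returning to real
      numbers requires a nonnegative right-hand side. It is a limit of bounds for the nonnegative
      shifted energies of the \<open>f n\<close>.\<close>
    have "0 \<le> c + lam * (\<epsilon> * M - 1 + G \<epsilon>)"
    proof (rule LIMSEQ_le_const)
      show "(\<lambda>n. c + \<delta> n + lam * (\<epsilon> * M - 1 + G \<epsilon>)) \<longlonglongrightarrow> c + lam * (\<epsilon> * M - 1 + G \<epsilon>)"
        using tendsto_add[OF tendsto_add[OF tendsto_const \<delta>] tendsto_const] by simp
      have "0 \<le> c + \<delta> n + lam * (\<epsilon> * M - 1 + G \<epsilon>)" for n
      proof -
        have "0 \<le> enn2real (mean_cost (f n)) / 2 + lam * (E (f n) + \<epsilon> * (\<integral>x. f n x * (norm x)\<^sup>2 \<partial>lborel) - 1 + G \<epsilon>)"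
          by (rule add_nonneg_nonneg[OF _ mult_nonneg_nonneg[OF less_imp_le[OF lam_pos]
            entropy_gaussian_integral(1)[OF f that, folded G_def E_def]]]) simp
        also have "\<dots> = energy (f n) + lam * (\<epsilon> * (\<integral>x. f n x * (norm x)\<^sup>2 \<partial>lborel) - 1 + G \<epsilon>)"
          by (simp add: energy_def E_def algebra_simps)
        also have "\<dots> \<le> c + \<delta> n + lam * (\<epsilon> * M - 1 + G \<epsilon>)"
          using energy_le[of n] M[of n] lam_pos \<open>0 < \<epsilon>\<close> by (intro add_mono mult_left_mono diff_mono) auto
        finally show ?thesis .
      qed
      then show "\<exists>N. \<forall>n\<ge>N. 0 \<le> c + \<delta> n + lam * (\<epsilon> * M - 1 + G \<epsilon>)"
        by blast
    qed
    with le have "1 / 2 * ?V + lam * (E g + \<epsilon> * ?m - 1 + G \<epsilon>) \<le> c + lam * (\<epsilon> * M - 1 + G \<epsilon>)"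
      by (simp only: ennreal_le_iff)
    then show ?thesis
      by (simp add: energy_def E_def algebra_simps)
  qed
  have "((\<lambda>\<epsilon>. c + \<epsilon> * (lam * (M - (\<integral>x. g x * (norm x)\<^sup>2 \<partial>lborel)))) \<longlongrightarrow>
      c + 0 * (lam * (M - (\<integral>x. g x * (norm x)\<^sup>2 \<partial>lborel)))) (at_right 0)"
    by (intro tendsto_intros)
  moreover have "eventually (\<lambda>\<epsilon>. energy g \<le> c + \<epsilon> * (lam * (M - (\<integral>x. g x * (norm x)\<^sup>2 \<partial>lborel)))) (at_right 0)"
    using eventually_at_right_less by (rule eventually_mono) (rule g_le)
  ultimately have "energy g \<le> c + 0 * (lam * (M - (\<integral>x. g x * (norm x)\<^sup>2 \<partial>lborel)))"
    by (rule tendsto_lowerbound) simp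
  then show "energy g \<le> c"
    by simp
qed

lemma ex_energy_minimizer:
  obtains g where "finite_entropy_density \<Omega> g" "\<And>f. finite_entropy_density \<Omega> f \<Longrightarrow> energy g \<le> energy f"
proof -
  obtain C where coercive: "\<And>f. finite_entropy_density \<Omega> f \<Longrightarrow> (\<integral>x. f x * (norm x)\<^sup>2 \<partial>lborel) \<le> 8 * energy f + C"
    and lower: "\<And>f. finite_entropy_density \<Omega> f \<Longrightarrow> - C \<le> 8 * energy f"
    using energy_coercive by blast
  obtain f0 where f0: "finite_entropy_density \<Omega> f0"
    using ex_finite_entropy_density[OF open_domain nonempty] by blast
  define c where "c = (INF f\<in>Collect (finite_entropy_density \<Omega>). energy f)"
  have bdd: "bdd_below (energy ` Collect (finite_entropy_density \<Omega>))"
  proof (rule bdd_belowI2)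
    fix f assume "f \<in> Collect (finite_entropy_density \<Omega>)"
    then show "- C / 8 \<le> energy f"
      using lower[of f] by simp
  qed
  have c_le: "c \<le> energy f" if "finite_entropy_density \<Omega> f" for f
    unfolding c_def using bdd that by (intro cINF_lower) auto
  \<comment> \<open>The prefactor \<open>lam / 4\<close> cancels the coefficient of the convexity
    gap, so that the squared distances of the square roots are bounded by the plain power
    \<open>(1 / 4) ^ n\<close>.\<close>
  define \<delta> where "\<delta> n = lam / 4 * (1 / 4) ^ n" for n :: nat
  have \<delta>_pos: "0 < \<delta> n" for n
    using lam_pos by (simp add: \<delta>_def)
  have "\<exists>f. finite_entropy_density \<Omega> f \<and> energy f < c + \<delta> n" for n
  proof -
    have "c < c + \<delta> n"
      using \<delta>_pos by simp
    then show ?thesis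
      using f0 bdd unfolding c_def by (subst (asm) cINF_less_iff) auto
  qed
  then obtain f where f: "\<And>n. finite_entropy_density \<Omega> (f n)" and f_le: "\<And>n. energy (f n) < c + \<delta> n"
    by metis
  note fD = finite_entropy_densityD[OF f]
  note [measurable] = fD(1)
  \<comment> \<open>The midpoint has energy at least \<open>c\<close>, so the gap is at most the
    mean of \<open>\<delta> m\<close> and \<open>\<delta> n\<close>.\<close>
  have cauchy: "(\<integral>x. (sqrt (f m x) - sqrt (f n x))\<^sup>2 \<partial>lborel) \<le> (1 / 4) ^ n" if "n \<le> m" for m n
  proof -
    have "\<delta> m \<le> \<delta> n"
      unfolding \<delta>_def using lam_pos that by (intro mult_left_mono power_decreasing) auto
    then have "lam / 4 * (\<integral>x. (sqrt (f m x) - sqrt (f n x))\<^sup>2 \<partial>lborel) \<le> lam / 4 * (1 / 4) ^ n"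
      using energy_midpoint_gap[OF f f, of m n] f_le[of m] f_le[of n]
        c_le[OF finite_entropy_density_midpoint(1)[OF f f, of m n]]
      unfolding \<delta>_def[symmetric] by (simp add: field_simps)
    then show ?thesis
      using lam_pos by simp
  qed
  have cauchy': "(\<integral>\<^sup>+ x. ennreal ((sqrt (f m x) - sqrt (f n x))\<^sup>2) \<partial>lborel) \<le> ennreal ((1 / 4) ^ n)"
    if "n \<le> m" for m n
    using cauchy[OF that] finite_entropy_density_midpoint(2)[OF f f, of m n]
    by (subst nn_integral_eq_integral) (auto intro: ennreal_leI)
  have conv: "AE x in lborel. convergent (\<lambda>n. f n x)"
  proof -
    \<comment> \<open>The weight \<open>2 ^ n\<close> is halfway in scale: weighted by it the
      integrals are still summable, as \<open>2 ^ n * (1 / 4) ^ n = (1 / 2) ^ n\<close>, and it is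
      strong enough to make the increments themselves absolutely summable at almost every
      point.\<close>
    let ?d = "\<lambda>n x. 2 ^ n * (sqrt (f (Suc n) x) - sqrt (f n x))\<^sup>2"
    have "(\<integral>\<^sup>+ x. (\<Sum>n. ennreal (?d n x)) \<partial>lborel) = (\<Sum>n. \<integral>\<^sup>+ x. ennreal (?d n x) \<partial>lborel)"
      by (rule nn_integral_suminf) simp
    also have "\<dots> \<le> (\<Sum>n. ennreal ((1 / 2) ^ n))"
    proof (intro suminf_le summableI allI)
      fix n
      have "(\<integral>\<^sup>+ x. ennreal (?d n x) \<partial>lborel) = ennreal (2 ^ n) * (\<integral>\<^sup>+ x. ennreal ((sqrt (f (Suc n) x) - sqrt (f n x))\<^sup>2) \<partial>lborel)"
        by (subst nn_integral_cmult[symmetric]) (auto simp: ennreal_mult)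
      also have "\<dots> \<le> ennreal (2 ^ n) * ennreal ((1 / 4) ^ n)"
        by (intro mult_left_mono cauchy') auto
      also have "\<dots> = ennreal ((1 / 2) ^ n)"
        by (simp add: power_mult_distrib[symmetric] flip: ennreal_mult)
      finally show "(\<integral>\<^sup>+ x. ennreal (?d n x) \<partial>lborel) \<le> ennreal ((1 / 2) ^ n)" .
    qed
    also have "\<dots> = ennreal (\<Sum>n. (1 / 2) ^ n)"
      by (rule suminf_ennreal2) (auto intro: summable_geometric)
    finally have "(\<integral>\<^sup>+ x. (\<Sum>n. ennreal (?d n x)) \<partial>lborel) \<noteq> \<infinity>"
      by (auto simp: top_unique)
    then have "AE x in lborel. (\<Sum>n. ennreal (?d n x)) \<noteq> \<infinity>"
      by (intro nn_integral_PInf_AE) auto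
    then show ?thesis
    proof eventually_elim
      case (elim x)
      then have sum_d: "summable (\<lambda>n. ?d n x)"
        by (intro summable_suminf_not_top) auto
      have "summable (\<lambda>n. sqrt (f (Suc n) x) - sqrt (f n x))"
      proof (rule summable_comparison_test')
        show "summable (\<lambda>n. ?d n x + (1 / 2) ^ n)"
          by (intro summable_add sum_d summable_geometric) simp
        fix n :: nat
        let ?u = "sqrt (f (Suc n) x) - sqrt (f n x)"
        \<comment> \<open>\<open>2 \<bar>u\<bar> \<le> 2\<^sup>n u\<^sup>2 + 2\<^sup>-\<^sup>n\<close>\<close>
        have "0 \<le> (2 ^ n * \<bar>?u\<bar> - 1)\<^sup>2 / 2 ^ n"
          by simp
        also have "\<dots> = ?d n x + (1 / 2) ^ n - 2 * \<bar>?u\<bar>"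
          by (simp add: power2_diff power_mult_distrib field_simps) (simp add: power2_eq_square)
        finally have "2 * \<bar>?u\<bar> \<le> ?d n x + (1 / 2) ^ n"
          by simp
        moreover have "norm ?u \<le> 2 * \<bar>?u\<bar>"
          by simp
        ultimately show "norm ?u \<le> ?d n x + (1 / 2) ^ n"
          by (rule order_trans[rotated])
      qed
      then have "convergent (\<lambda>n. sqrt (f n x) - sqrt (f 0 x))"
        by (simp add: summable_iff_convergent sum_lessThan_telescope[of "\<lambda>n. sqrt (f n x)"])
      then obtain l where "(\<lambda>n. sqrt (f n x) - sqrt (f 0 x)) \<longlonglongrightarrow> l"
        by (auto simp: convergent_def)
      from tendsto_power[OF tendsto_add[OF this tendsto_const[of "sqrt (f 0 x)"]], of 2]
      show ?case
        using fD(2) by (auto simp: convergent_def)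
    qed
  qed
  \<comment> \<open>The lower limit, defined at every point, makes \<open>g\<close> Borel and
    exactly zero outside \<open>\<Omega>\<close>; \<open>enn2real\<close> supplies 0 where it is
    infinite, which happens only on a null set.\<close>
  define g where "g x = enn2real (liminf (\<lambda>n. ennreal (f n x)))" for x
  have [measurable]: "g \<in> borel_measurable borel"
    unfolding g_def by measurable
  have nonneg: "0 \<le> g x" for x
    by (simp add: g_def)
  have lim: "AE x in lborel. (\<lambda>n. f n x) \<longlonglongrightarrow> g x"
    using conv
  proof eventually_elim
    case (elim x)
    then obtain l where l: "(\<lambda>n. f n x) \<longlonglongrightarrow> l"
      by (auto simp: convergent_def)
    then have "0 \<le> l"
      by (rule LIMSEQ_le_const) (auto intro: fD(2))
    have "liminf (\<lambda>n. ennreal (f n x)) = ennreal l"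
      using l by (intro lim_imp_Liminf tendsto_ennrealI) simp_all
    then show ?case
      using l \<open>0 \<le> l\<close> by (simp add: g_def)
  qed
  have f_mass: "(\<integral>\<^sup>+ x. ennreal (f n x) \<partial>lborel) = 1" for n
    using fD(2,6,7) by (simp add: nn_integral_eq_integral)
  have "(\<integral>\<^sup>+ x. ennreal (g x) \<partial>lborel) = (\<integral>\<^sup>+ x. liminf (\<lambda>n. ennreal (f n x)) \<partial>lborel)"
    using lim by (intro nn_integral_cong_AE) (auto elim!: eventually_mono intro!: lim_imp_Liminf[symmetric] tendsto_ennrealI)
  also have "\<dots> \<le> liminf (\<lambda>n. \<integral>\<^sup>+ x. ennreal (f n x) \<partial>lborel)"
    by (rule nn_integral_liminf) simp
  also have "\<dots> = 1"
    by (simp add: f_mass Liminf_const)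
  finally have le_1: "(\<integral>\<^sup>+ x. ennreal (g x) \<partial>lborel) \<le> 1" .
  have close: "(\<integral>\<^sup>+ x. ennreal ((sqrt (g x) - sqrt (f n x))\<^sup>2) \<partial>lborel) \<le> ennreal ((1 / 4) ^ n)" for n
  proof -
    have "(\<integral>\<^sup>+ x. ennreal ((sqrt (g x) - sqrt (f n x))\<^sup>2) \<partial>lborel) =
        (\<integral>\<^sup>+ x. liminf (\<lambda>m. ennreal ((sqrt (f m x) - sqrt (f n x))\<^sup>2)) \<partial>lborel)"
      using lim by (intro nn_integral_cong_AE)
        (auto elim!: eventually_mono intro!: lim_imp_Liminf[symmetric] tendsto_ennrealI tendsto_intros)
    also have "\<dots> \<le> liminf (\<lambda>m. \<integral>\<^sup>+ x. ennreal ((sqrt (f m x) - sqrt (f n x))\<^sup>2) \<partial>lborel)"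
      by (rule nn_integral_liminf) simp
    also have "\<dots> \<le> liminf (\<lambda>m. ennreal ((1 / 4) ^ n))"
      using cauchy' by (intro Liminf_mono) (auto simp: eventually_sequentially)
    finally show ?thesis
      by (simp add: Liminf_const)
  qed
  have "1 \<le> (\<integral>\<^sup>+ x. ennreal (g x) \<partial>lborel)"
  proof -
    define m where "m = enn2real (\<integral>\<^sup>+ x. ennreal (g x) \<partial>lborel)"
    have m: "(\<integral>\<^sup>+ x. ennreal (g x) \<partial>lborel) = ennreal m"
      unfolding m_def using le_less_trans[OF le_1] by (intro ennreal_enn2real[symmetric]) simp
    \<comment> \<open>Young's inequality with weight \<open>(1 / 2) ^ n\<close> compares
      \<open>f n\<close> with \<open>g\<close>. The large factor \<open>1 + 2 ^ n\<close> is beaten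
      by the squared distance \<open>(1 / 4) ^ n\<close>, so both errors vanish and no mass can have
      been lost.\<close>
    have "1 \<le> (1 + (1 / 2) ^ n) * m + (1 + 2 ^ n) * (1 / 4) ^ n" for n
    proof -
      let ?s = "(1 / 2) ^ n :: real" and ?t = "1 + 2 ^ n :: real"
      have "1 = (\<integral>\<^sup>+ x. ennreal (f n x) \<partial>lborel)"
        by (simp add: f_mass)
      also have "\<dots> \<le> (\<integral>\<^sup>+ x. ennreal (1 + ?s) * ennreal (g x) + ennreal ?t * ennreal ((sqrt (g x) - sqrt (f n x))\<^sup>2) \<partial>lborel)"
      proof (rule nn_integral_mono)
        fix x
        have "f n x \<le> (1 + ?s) * g x + ?t * (sqrt (g x) - sqrt (f n x))\<^sup>2"
          using square_sum_le[of ?s "sqrt (g x)" "sqrt (f n x) - sqrt (g x)"] nonneg[of x] fD(2)[of n x]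
          by (simp add: power_one_over power2_commute)
        then show "ennreal (f n x) \<le> ennreal (1 + ?s) * ennreal (g x) + ennreal ?t * ennreal ((sqrt (g x) - sqrt (f n x))\<^sup>2)"
          using nonneg[of x] by (simp flip: ennreal_mult ennreal_plus)
      qed
      also have "\<dots> = ennreal (1 + ?s) * ennreal m + ennreal ?t * (\<integral>\<^sup>+ x. ennreal ((sqrt (g x) - sqrt (f n x))\<^sup>2) \<partial>lborel)"
        by (simp add: nn_integral_add nn_integral_cmult m del: ennreal_plus)
      also have "\<dots> \<le> ennreal (1 + ?s) * ennreal m + ennreal ?t * ennreal ((1 / 4) ^ n)"
        by (intro add_left_mono mult_left_mono close) simp
      also have "\<dots> = ennreal ((1 + ?s) * m + ?t * (1 / 4) ^ n)"
        by (simp add: m_def flip: ennreal_mult ennreal_plus)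
      finally show ?thesis
        by (simp del: ennreal_plus)
    qed
    moreover have "(\<lambda>n. (1 + (1 / 2) ^ n) * m + (1 + 2 ^ n) * (1 / 4) ^ n) \<longlonglongrightarrow> (1 + 0) * m + (0 + 0)"
    proof -
      have *: "(1 + 2 ^ n) * (1 / 4) ^ n = (1 / 4) ^ n + (1 / 2 :: real) ^ n" for n :: nat
        by (simp add: distrib_right power_mult_distrib[symmetric])
      show ?thesis
        unfolding * by (intro tendsto_intros LIMSEQ_power_zero) auto
    qed
    ultimately have "1 \<le> m"
      by (intro LIMSEQ_le_const[where X="\<lambda>n. (1 + (1 / 2) ^ n) * m + (1 + 2 ^ n) * (1 / 4) ^ n"]) auto
    then show ?thesis
      unfolding m by simp
  qed
  with le_1 have mass: "(\<integral>\<^sup>+ x. ennreal (g x) \<partial>lborel) = 1"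
    by (rule antisym)
  have M: "(\<integral>x. f n x * (norm x)\<^sup>2 \<partial>lborel) \<le> 8 * (c + lam / 4) + C" for n
  proof -
    have "\<delta> n \<le> lam / 4"
      unfolding \<delta>_def using lam_pos by (intro mult_left_le power_le_one) auto
    then show ?thesis
      using coercive[OF f[of n]] f_le[of n] by simp
  qed
  have "\<delta> \<longlonglongrightarrow> lam / 4 * 0"
    unfolding \<delta>_def by (intro tendsto_intros LIMSEQ_power_zero) simp
  then have "\<delta> \<longlonglongrightarrow> 0"
    by simp
  have "g x = 0" if "x \<notin> \<Omega>" for x
    using fD(3)[OF that] by (simp add: g_def Liminf_const)
  then have "finite_entropy_density \<Omega> g" "energy g \<le> c"
    using energy_limit[OF f _ nonneg _ mass lim less_imp_le[OF f_le] \<open>\<delta> \<longlonglongrightarrow> 0\<close> M] by auto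
  with c_le show thesis
    by (intro that) (auto intro: order_trans)
qed

lemma energy_minimizer_unique:
  assumes f: "finite_entropy_density \<Omega> f" and g: "finite_entropy_density \<Omega> g"
    and min: "\<And>h. finite_entropy_density \<Omega> h \<Longrightarrow> energy f \<le> energy h" and le: "energy g \<le> energy f"
  shows "density lborel f = density lborel g"
proof -
  note fD = finite_entropy_densityD[OF f] and gD = finite_entropy_densityD[OF g]
  note [measurable] = fD(1) gD(1)
  have "lam / 4 * (\<integral>x. (sqrt (f x) - sqrt (g x))\<^sup>2 \<partial>lborel) \<le> 0"
    using energy_midpoint_gap[OF f g] min[OF finite_entropy_density_midpoint(1)[OF f g]] le by simp
  then have "(\<integral>x. (sqrt (f x) - sqrt (g x))\<^sup>2 \<partial>lborel) \<le> 0"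
    using lam_pos by (simp add: mult_le_0_iff)
  then have "(\<integral>x. (sqrt (f x) - sqrt (g x))\<^sup>2 \<partial>lborel) = 0"
    by (intro antisym Bochner_Integration.integral_nonneg) auto
  then have "AE x in lborel. (sqrt (f x) - sqrt (g x))\<^sup>2 = 0"
    by (subst (asm) integral_nonneg_eq_0_iff_AE) (auto intro: finite_entropy_density_midpoint(2)[OF f g])
  then have "AE x in lborel. ennreal (f x) = ennreal (g x)"
    by eventually_elim simp
  then show ?thesis
    by (intro density_cong) auto
qed

text \<open>A measure whose objective does not exceed that of \<open>density lborel g\<close> has
  finite objective, hence a density of the class, and the comparison becomes one of real energies.
  Uniqueness concerns the measure, its density being determined only almost everywhere.\<close>

lemma ex1_minimizer: "\<exists>!\<rho>. is_arg_min (objective \<Omega> lam P) (\<lambda>\<rho>. \<rho> \<in> P2) \<rho>"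
proof -
  obtain g where g: "finite_entropy_density \<Omega> g"
    and min: "\<And>f. finite_entropy_density \<Omega> f \<Longrightarrow> energy g \<le> energy f"
    using ex_energy_minimizer by blast
  show ?thesis
  proof (rule ex1I)
    show "is_arg_min (objective \<Omega> lam P) (\<lambda>\<rho>. \<rho> \<in> P2) (density lborel g)"
      unfolding is_arg_min_def
    proof (intro conjI notI)
      show "density lborel g \<in> P2"
        by (rule finite_entropy_densityD(4)[OF g])
      assume "\<exists>\<mu>. \<mu> \<in> P2 \<and> objective \<Omega> lam P \<mu> < objective \<Omega> lam P (density lborel g)"
      then obtain \<mu> where \<mu>: "\<mu> \<in> P2" "objective \<Omega> lam P \<mu> < ereal (energy g)"
        by (auto simp: objective_density[OF g])
      then have "objective \<Omega> lam P \<mu> \<noteq> \<infinity>"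
        by auto
      then obtain f where f: "finite_entropy_density \<Omega> f" "\<mu> = density lborel f"
        using objective_finite_imp_density[OF \<mu>(1)] by blast
      then show False
        using \<mu>(2) min[OF f(1)] by (simp add: objective_density)
    qed
  next
    fix \<mu> assume "is_arg_min (objective \<Omega> lam P) (\<lambda>\<rho>. \<rho> \<in> P2) \<mu>"
    then have "\<mu> \<in> P2" and \<mu>: "objective \<Omega> lam P \<mu> \<le> ereal (energy g)"
      using finite_entropy_densityD(4)[OF g] objective_density[OF g]
      by (auto simp: is_arg_min_def not_less)
    then have "objective \<Omega> lam P \<mu> \<noteq> \<infinity>"
      by auto
    then obtain f where f: "finite_entropy_density \<Omega> f" "\<mu> = density lborel f"
      using objective_finite_imp_density[OF \<open>\<mu> \<in> P2\<close>] by blast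
    with \<mu> have "energy f \<le> energy g"
      by (simp add: objective_density)
    then show "\<mu> = density lborel g"
      using energy_minimizer_unique[OF g f(1) min] by (simp add: f(2))
  qed
qed

end

theorem proposition2p2:
  fixes \<Omega> :: "'a::euclidean_space set"
    and lam :: real
    and P :: "'a measure measure"
  assumes "\<Omega> \<noteq> {}" and "open \<Omega>" and "connected \<Omega>" and "negligible (frontier \<Omega>)"
    and "lam > 0"
    and "prob_space P" and "sets P = sets borel_P2"
    and "(\<integral>\<^sup>+ \<nu>. second_moment \<nu> \<partial>P) < \<infinity>"
  shows "\<exists>!\<rho>. is_arg_min (objective \<Omega> lam P) (\<lambda>\<rho>. \<rho> \<in> P2) \<rho>"
proof -
  interpret penalized_barycenter \<Omega> lam P
    using assms by (intro penalized_barycenter.intro)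
  show ?thesis
    by (rule ex1_minimizer)
qed

end
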